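(* Let $Y_1,Y_2,\dots$ be i.i.d. from the folded normal law with density $f(\cdot;\mu_0,\sigma_0)$, where $\theta_0=(\mu_0,\sigma_0)\in\mathbb{R}\times(0,\infty)$. Let $\ell_n(\theta)=\sum_{i=1}^n\log f(Y_i;\theta)$ for $\theta\in\Theta=\mathbb{R}\times(0,\infty)$, let $\widehat\Theta_n:=\arg\max_{\theta\in\Theta}\ell_n(\theta)$ be the (possibly set-valued) MLE set, and let $\pi(\theta):=[\theta]$ be the quotient map $\Theta\to\Theta/G$. Then, in the Hausdorff distance $d_H$ on $(\Theta/G,d_G)$, $$d_H\big(\pi(\widehat\Theta_n),\{[\theta_0]\}\big)\to 0\quad\text{in probability.}$$ Equivalently, any measurable selection $\hat\theta_n\in\widehat\Theta_n$ satisfies $d_G(\hat\theta_n,\theta_0)\to0$ in probability.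
   Context: The folded normal density with parameters $\mu\in\mathbb{R}$, $\sigma>0$ is $f(y;\mu,\sigma)=\frac1\sigma\{\varphi(\frac{y-\mu}{\sigma})+\varphi(\frac{y+\mu}{\sigma})\}$ for $y\ge0$, with $\varphi(z)=(2\pi)^{-1/2}e^{-z^2/2}$. The group $G=\{+1,-1\}$ acts on $\Theta=\mathbb{R}\times(0,\infty)$ (Euclidean metric) by $g\cdot(\mu,\sigma)=(g\mu,\sigma)$; $[\theta]$ is the orbit of $\theta$, i.e. $[(\mu,\sigma)]=\{(\mu,\sigma),(-\mu,\sigma)\}$. The orbit distance is $d_G((\mu,\sigma),(\mu',\sigma'))=\min\{\|(\mu,\sigma)-(\mu',\sigma')\|_2,\|(\mu,\sigma)-(-\mu',\sigma')\|_2\}$, which induces a metric on $\Theta/G$ by $d_G([\theta],[\theta'])=d_G(\theta,\theta')$. The Hausdorff distance of nonempty compact sets $A,B$ is $d_H(A,B)=\max\{\sup_{a\in A}d_G(a,B),\sup_{b\in B}d_G(b,A)\}$. (Almost surely for $n\ge2$, the set $\widehat\Theta_n$ is nonempty.) *)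

theory Defs
  imports "HOL-Probability.Probability"
begin

definition folded_normal_density :: "real \<times> real \<Rightarrow> real \<Rightarrow> real" where
  "folded_normal_density \<theta> y = (case \<theta> of (\<mu>, \<sigma>) \<Rightarrow>
     if 0 \<le> y
     then 1 / \<sigma> * (std_normal_density ((y - \<mu>) / \<sigma>) + std_normal_density ((y + \<mu>) / \<sigma>))
     else 0)"

definition param_space :: "(real \<times> real) set" where
  "param_space = UNIV \<times> {0<..}"

text \<open>The group with elements 1 and -1 acts by changing the sign of the location parameter.\<close>

definition sign_group :: "real set" where
  "sign_group = {1, -1}"

definition sign_act :: "real \<Rightarrow> real \<times> real \<Rightarrow> real \<times> real" where
  "sign_act g \<theta> = (g * fst \<theta>, snd \<theta>)"

definition orbit :: "real \<times> real \<Rightarrow> (real \<times> real) set" where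
  "orbit \<theta> = (\<lambda>g. sign_act g \<theta>) ` sign_group"

definition orbit_dist :: "real \<times> real \<Rightarrow> real \<times> real \<Rightarrow> real" where
  "orbit_dist \<theta> \<theta>' = min (dist \<theta> \<theta>') (dist \<theta> (sign_act (-1) \<theta>'))"

text \<open>The distance between two orbits is the common value of \<^const>\<open>orbit_dist\<close> on all pairs of
  representatives; see \<open>quotient_dist_orbit\<close> below.\<close>

definition quotient_dist :: "(real \<times> real) set \<Rightarrow> (real \<times> real) set \<Rightarrow> real" where
  "quotient_dist A B = the_elem ((\<lambda>(\<theta>, \<theta>'). orbit_dist \<theta> \<theta>') ` (A \<times> B))"

lemma orbit_eq: "orbit (\<mu>, \<sigma>) = {(\<mu>, \<sigma>), (- \<mu>, \<sigma>)}"
  by (auto simp: orbit_def sign_group_def sign_act_def)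

lemma orbit_dist_eq:
  "orbit_dist (\<mu>, \<sigma>) (\<mu>', \<sigma>') = min (dist (\<mu>, \<sigma>) (\<mu>', \<sigma>')) (dist (\<mu>, \<sigma>) (- \<mu>', \<sigma>'))"
  by (simp add: orbit_dist_def sign_act_def)

lemma quotient_dist_orbit: "quotient_dist (orbit \<theta>) (orbit \<theta>') = orbit_dist \<theta> \<theta>'"
proof -
  obtain \<mu> \<sigma> \<mu>' \<sigma>' where eq: "\<theta> = (\<mu>, \<sigma>)" "\<theta>' = (\<mu>', \<sigma>')"
    by (cases \<theta>, cases \<theta>')
  have "\<bar>- \<mu> - \<mu>'\<bar> = \<bar>\<mu> + \<mu>'\<bar>" "\<bar>\<mu>' - \<mu>\<bar> = \<bar>\<mu> - \<mu>'\<bar>"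
    by linarith+
  then have "(\<lambda>(\<theta>, \<theta>'). orbit_dist \<theta> \<theta>') ` (orbit \<theta> \<times> orbit \<theta>') = {orbit_dist \<theta> \<theta>'}"
    by (auto simp: eq orbit_eq orbit_dist_eq dist_Pair_Pair dist_real_def min.commute)
  then show ?thesis
    by (simp add: quotient_dist_def)
qed

text \<open>Hausdorff distance with respect to \<open>d\<close>. The values are in \<^typ>\<open>ennreal\<close>, so that the distance
  between the empty set and a nonempty set, and between an unbounded and a bounded set, is \<open>\<infinity>\<close>.\<close>

definition hausdorff_dist :: "('a \<Rightarrow> 'a \<Rightarrow> real) \<Rightarrow> 'a set \<Rightarrow> 'a set \<Rightarrow> ennreal" where
  "hausdorff_dist d A B =
     max (SUP a\<in>A. INF b\<in>B. ennreal (d a b)) (SUP b\<in>B. INF a\<in>A. ennreal (d b a))"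

text \<open>An observation \<open>y i < 0\<close> would contribute \<open>ln 0 = 0\<close>; under the folded normal law this has
  probability zero.\<close>

definition log_likelihood :: "(nat \<Rightarrow> real) \<Rightarrow> nat \<Rightarrow> real \<times> real \<Rightarrow> real" where
  "log_likelihood y n \<theta> = (\<Sum>i<n. ln (folded_normal_density \<theta> (y i)))"

definition mle_set :: "(nat \<Rightarrow> real) \<Rightarrow> nat \<Rightarrow> (real \<times> real) set" where
  "mle_set y n = {\<theta>. is_arg_max (log_likelihood y n) (\<lambda>\<theta>. \<theta> \<in> param_space) \<theta>}"

definition tendsto_0_in_prob :: "'a measure \<Rightarrow> (nat \<Rightarrow> 'a \<Rightarrow> ennreal) \<Rightarrow> bool" where
  "tendsto_0_in_prob M X \<longleftrightarrow>
     (\<forall>n. X n \<in> borel_measurable M) \<and>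
     (\<forall>\<epsilon>::real. \<epsilon> > 0 \<longrightarrow> (\<lambda>n. measure M {\<omega> \<in> space M. X n \<omega> > ennreal \<epsilon>}) \<longlonglongrightarrow> 0)"

end

(*
  Write l(theta, y) for the log density at y >= 0 and L(theta) for its mean under the true law.

  Existence and coercivity: the average log density of a sample is at most
  -ln sigma - (s + (|mu| - m)^2) / (2 sigma^2), with m the sample mean and s the sample variance.
  If s > 0, its superlevel sets are therefore relatively compact in the parameter space, so a
  maximiser exists; if s stays away from 0 and m stays bounded, one compact set K serves for all
  samples. Both hold with high probability by the weak law of large numbers.

  Consistency (Wald): L is maximal exactly on the orbit of theta_0, by Gibbs' inequality and
  identifiability up to sign (sigma is read off from l(theta, y) / y^2 at infinity, |mu| from
  l(theta, 0)). Since ln cosh is 1-Lipschitz, |l(theta, y) - l(theta', y)| is at most (1 + y^2) times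
  a gap that is continuous in theta' and vanishes at theta. Hence finitely many parameters control
  the average log density on the part of K at distance at least epsilon from the orbit.
*)
theory Submission
  imports Defs
begin

text \<open>Convergence in probability includes the claim that the Hausdorff distance is a random
  variable, and this is an obstacle separate from consistency, since the MLE set varies over an
  uncountable parameter space. For nonnegative observations that are not all equal, compact
  superlevel sets allow the event that some maximiser lies farther than \<open>c\<close> from the
  true orbit to be expressed by approximate maximisers in a countable dense set. If all observations
  coincide, the likelihood is unbounded as \<sigma> tends to 0, the MLE set is empty and the
  distance is infinite. What remains is the null event of a negative observation, where the
  convention \<open>ln 0 = 0\<close> distorts the likelihood; this is why the completion of the
  measure appears. The averaged functions grow at most quadratically, so fourth moments of the law
  are what Chebyshev's inequality requires. It handles one function at a time, which is why the
  consistency argument is reduced to finitely many parameters.\<close>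

definition lncosh :: "real \<Rightarrow> real" where
  "lncosh x = ln (cosh x)"

text \<open>For \<open>y \<ge> 0\<close> the two Gaussian terms of the density combine to a hyperbolic cosine, and
  \<open>log_density \<theta> y\<close> is the logarithm of the density. For \<open>y < 0\<close>, where the density vanishes, it keeps
  the same formula.\<close>

definition log_density :: "real \<times> real \<Rightarrow> real \<Rightarrow> real" where
  "log_density \<theta> y = (case \<theta> of (\<mu>, \<sigma>) \<Rightarrow>
     ln (2 / sqrt (2 * pi)) - ln \<sigma> - (y\<^sup>2 + \<mu>\<^sup>2) / (2 * \<sigma>\<^sup>2) + lncosh (y * \<mu> / \<sigma>\<^sup>2))"

text \<open>Replacing \<open>b\<close> by \<open>a\<close> multiplies each of the two exponentials
  in \<open>cosh\<close> by at most \<open>exp \<bar>a - b\<bar>\<close>.\<close>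

lemma lncosh_lipschitz: "\<bar>lncosh a - lncosh b\<bar> \<le> \<bar>a - b\<bar>"
proof -
  have le: "lncosh a \<le> lncosh b + \<bar>a - b\<bar>" for a b
  proof -
    have "exp a \<le> exp b * exp \<bar>a - b\<bar>" "exp (- a) \<le> exp (- b) * exp \<bar>a - b\<bar>"
      by (auto simp flip: exp_add)
    then have "cosh a \<le> cosh b * exp \<bar>a - b\<bar>"
      by (simp add: cosh_def field_simps)
    then have "ln (cosh a) \<le> ln (cosh b * exp \<bar>a - b\<bar>)"
      by (simp add: cosh_real_pos)
    then show ?thesis
      by (simp add: lncosh_def ln_mult cosh_real_pos)
  qed
  from le[of a b] le[of b a] show ?thesis by (simp add: abs_minus_commute abs_le_iff)
qed

lemma lncosh_0 [simp]: "lncosh 0 = 0"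
  by (simp add: lncosh_def)

lemma lncosh_nonneg: "0 \<le> lncosh x"
  by (simp add: lncosh_def cosh_real_ge_1)

lemma lncosh_le: "lncosh x \<le> \<bar>x\<bar>"
  using lncosh_lipschitz[of x 0] by simp

lemma continuous_on_lncosh [continuous_intros]:
  "continuous_on A f \<Longrightarrow> continuous_on A (\<lambda>x. lncosh (f x))"
  unfolding lncosh_def by (intro continuous_intros) (auto simp: less_imp_neq[symmetric])

lemma measurable_lncosh [measurable]: "lncosh \<in> borel_measurable borel"
  by (intro borel_measurable_continuous_onI continuous_intros)

lemma measurable_log_density [measurable]: "log_density \<theta> \<in> borel_measurable borel"
  unfolding log_density_def by (cases \<theta>) simp

text \<open>The second summand is the normal density centred at \<open>- \<mu>\<close>. This form
  brings in the known integrals and moments of \<open>normal_density\<close>.\<close>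

lemma folded_normal_density_altdef:
  assumes "\<sigma> > 0"
  shows "folded_normal_density (\<mu>, \<sigma>) y =
    indicator {0..} y * (normal_density \<mu> \<sigma> y + normal_density (- \<mu>) \<sigma> y)"
  using assms
  by (auto simp: folded_normal_density_def normal_density_def indicator_def real_sqrt_mult
      real_sqrt_power power_divide field_simps)

text \<open>Expanding both squares leaves a common Gaussian factor and the exponents
  \<open>y * \<mu> / \<sigma>\<^sup>2\<close> and its negative, whose exponentials add up to twice a
  \<open>cosh\<close>; hence the 2 in \<open>2 / sqrt (2 * pi)\<close>.\<close>

lemma exp_log_density:
  assumes "\<sigma> > 0" "0 \<le> y"
  shows "folded_normal_density (\<mu>, \<sigma>) y = exp (log_density (\<mu>, \<sigma>) y)"
proof -
  have e: "- (y - \<mu>)\<^sup>2 / (2 * \<sigma>\<^sup>2) = - ((y\<^sup>2 + \<mu>\<^sup>2) / (2 * \<sigma>\<^sup>2)) + y * \<mu> / \<sigma>\<^sup>2"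
    "- (y + \<mu>)\<^sup>2 / (2 * \<sigma>\<^sup>2) = - ((y\<^sup>2 + \<mu>\<^sup>2) / (2 * \<sigma>\<^sup>2)) + - (y * \<mu> / \<sigma>\<^sup>2)"
    using assms by (simp_all add: field_simps power2_eq_square)
  have s: "sqrt (2 * pi * \<sigma>\<^sup>2) = sqrt (2 * pi) * \<sigma>"
    using assms by (simp add: real_sqrt_mult)
  have "log_density (\<mu>, \<sigma>) y = ln (2 / sqrt (2 * pi)) + - ln \<sigma> +
      - ((y\<^sup>2 + \<mu>\<^sup>2) / (2 * \<sigma>\<^sup>2)) + ln (cosh (y * \<mu> / \<sigma>\<^sup>2))"
    by (simp add: log_density_def lncosh_def)
  then have "exp (log_density (\<mu>, \<sigma>) y) = 2 / sqrt (2 * pi) * inverse \<sigma> *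
      exp (- ((y\<^sup>2 + \<mu>\<^sup>2) / (2 * \<sigma>\<^sup>2))) * cosh (y * \<mu> / \<sigma>\<^sup>2)"
    using assms by (simp only: exp_add exp_minus[of "ln \<sigma>"]) (simp add: cosh_real_pos)
  also have "\<dots> = folded_normal_density (\<mu>, \<sigma>) y"
    using assms
    by (simp only: folded_normal_density_altdef normal_density_def s e exp_add diff_minus_eq_add)
      (simp add: cosh_def field_simps)
  finally show ?thesis by simp
qed

lemma ln_folded_normal_density:
  assumes "\<theta> \<in> param_space" "0 \<le> y"
  shows "ln (folded_normal_density \<theta> y) = log_density \<theta> y"
  using assms exp_log_density[of "snd \<theta>" y "fst \<theta>"] by (auto simp: param_space_def)

lemma log_density_le:
  assumes "\<sigma> > 0" "0 \<le> y"
  shows "log_density (\<mu>, \<sigma>) y \<le> - ln \<sigma> - (y - \<bar>\<mu>\<bar>)\<^sup>2 / (2 * \<sigma>\<^sup>2)"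
proof -
  have "2 \<le> sqrt (2 * pi)"
    using pi_gt3 by (intro real_le_rsqrt) auto
  then have "ln (2 / sqrt (2 * pi)) \<le> 0"
    by (subst ln_le_zero_iff) auto
  moreover have "lncosh (y * \<mu> / \<sigma>\<^sup>2) \<le> y * \<bar>\<mu>\<bar> / \<sigma>\<^sup>2"
    using lncosh_le[of "y * \<mu> / \<sigma>\<^sup>2"] assms by (simp add: abs_mult)
  moreover have "(y - \<bar>\<mu>\<bar>)\<^sup>2 / (2 * \<sigma>\<^sup>2) = (y\<^sup>2 + \<mu>\<^sup>2) / (2 * \<sigma>\<^sup>2) - y * \<bar>\<mu>\<bar> / \<sigma>\<^sup>2"
    using assms by (simp add: field_simps power2_eq_square)
  ultimately show ?thesis
    unfolding log_density_def prod.case by linarith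
qed

section \<open>Dependence of the log density on the parameter\<close>

definition log_density_gap :: "real \<times> real \<Rightarrow> real \<times> real \<Rightarrow> real" where
  "log_density_gap \<theta> \<theta>' = \<bar>ln (snd \<theta>) - ln (snd \<theta>')\<bar>
     + \<bar>(fst \<theta>)\<^sup>2 / (2 * (snd \<theta>)\<^sup>2) - (fst \<theta>')\<^sup>2 / (2 * (snd \<theta>')\<^sup>2)\<bar>
     + \<bar>1 / (2 * (snd \<theta>)\<^sup>2) - 1 / (2 * (snd \<theta>')\<^sup>2)\<bar>
     + \<bar>fst \<theta> / (snd \<theta>)\<^sup>2 - fst \<theta>' / (snd \<theta>')\<^sup>2\<bar>"

lemma log_density_gap_self [simp]: "log_density_gap \<theta> \<theta> = 0"
  by (simp add: log_density_gap_def)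

lemma log_density_gap_nonneg: "0 \<le> log_density_gap \<theta> \<theta>'"
  by (simp add: log_density_gap_def)

lemma continuous_on_log_density_gap: "continuous_on param_space (log_density_gap \<theta>)"
  unfolding log_density_gap_def param_space_def
  by (intro continuous_intros) auto

lemma abs_le_1_plus_square: "\<bar>y\<bar> \<le> 1 + y\<^sup>2" for y :: real
proof -
  have "0 \<le> (\<bar>y\<bar> - 1)\<^sup>2" by simp
  then have "2 * \<bar>y\<bar> \<le> 1 + y\<^sup>2" by (simp add: power2_diff)
  then show ?thesis using abs_ge_zero[of y] by linarith
qed

text \<open>The four summands of the gap compare the coefficients of the log density as a function
  of \<open>y\<close>. They enter with weights 1, 1, \<open>y\<^sup>2\<close> and, by the Lipschitz
  bound for \<open>lncosh\<close>, \<open>\<bar>y\<bar>\<close>; each weight is at most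
  \<open>1 + y\<^sup>2\<close>.\<close>

lemma log_density_diff_le:
  "\<bar>log_density \<theta> y - log_density \<theta>' y\<bar> \<le> (1 + y\<^sup>2) * log_density_gap \<theta> \<theta>'"
proof -
  obtain \<mu> \<sigma> \<mu>' \<sigma>' where eq: "\<theta> = (\<mu>, \<sigma>)" "\<theta>' = (\<mu>', \<sigma>')"
    by (cases \<theta>, cases \<theta>')
  define a b c d where "a = ln \<sigma> - ln \<sigma>'" and "b = \<mu>\<^sup>2 / (2 * \<sigma>\<^sup>2) - \<mu>'\<^sup>2 / (2 * \<sigma>'\<^sup>2)"
    and "c = 1 / (2 * \<sigma>\<^sup>2) - 1 / (2 * \<sigma>'\<^sup>2)" and "d = \<mu> / \<sigma>\<^sup>2 - \<mu>' / \<sigma>'\<^sup>2"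
  have 1: "\<bar>lncosh (y * \<mu> / \<sigma>\<^sup>2) - lncosh (y * \<mu>' / \<sigma>'\<^sup>2)\<bar> \<le> (1 + y\<^sup>2) * \<bar>d\<bar>"
  proof -
    have "\<bar>lncosh (y * \<mu> / \<sigma>\<^sup>2) - lncosh (y * \<mu>' / \<sigma>'\<^sup>2)\<bar> \<le> \<bar>y * d\<bar>"
      using lncosh_lipschitz[of "y * \<mu> / \<sigma>\<^sup>2" "y * \<mu>' / \<sigma>'\<^sup>2"] by (simp add: d_def right_diff_distrib)
    also have "\<dots> \<le> (1 + y\<^sup>2) * \<bar>d\<bar>"
      unfolding abs_mult by (intro mult_right_mono abs_le_1_plus_square) auto
    finally show ?thesis .
  qed
  have 2: "\<bar>u\<bar> \<le> (1 + y\<^sup>2) * \<bar>u\<bar>" for u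
    using mult_right_mono[of 1 "1 + y\<^sup>2" "\<bar>u\<bar>"] by simp
  have 3: "\<bar>y\<^sup>2 * c\<bar> \<le> (1 + y\<^sup>2) * \<bar>c\<bar>"
    unfolding abs_mult by (intro mult_right_mono) auto
  have "log_density \<theta> y - log_density \<theta>' y =
      - a - b - y\<^sup>2 * c + (lncosh (y * \<mu> / \<sigma>\<^sup>2) - lncosh (y * \<mu>' / \<sigma>'\<^sup>2))"
    by (simp add: eq log_density_def a_def b_def c_def add_divide_distrib algebra_simps)
  also have "\<bar>\<dots>\<bar> \<le> (1 + y\<^sup>2) * \<bar>a\<bar> + (1 + y\<^sup>2) * \<bar>b\<bar> + (1 + y\<^sup>2) * \<bar>c\<bar> + (1 + y\<^sup>2) * \<bar>d\<bar>"
    using 1 2[of a] 2[of b] 3 by linarith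
  also have "\<dots> = (1 + y\<^sup>2) * log_density_gap \<theta> \<theta>'"
    by (simp add: eq log_density_gap_def a_def b_def c_def d_def algebra_simps)
  finally show ?thesis .
qed

text \<open>Comparison with the parameter \<open>(0, 1)\<close>, whose log density is an explicit
  quadratic polynomial.\<close>

lemma log_density_quadratic_bound: "\<exists>C. \<forall>y. \<bar>log_density \<theta> y\<bar> \<le> C * (1 + y\<^sup>2)"
proof -
  have "\<bar>log_density \<theta> y\<bar> \<le> (\<bar>ln (2 / sqrt (2 * pi))\<bar> + 1 + log_density_gap \<theta> (0, 1)) * (1 + y\<^sup>2)" for y
  proof -
    have "\<bar>log_density (0, 1) y\<bar> \<le> \<bar>ln (2 / sqrt (2 * pi))\<bar> + y\<^sup>2 / 2"
      using abs_triangle_ineq4[of "ln (2 / sqrt (2 * pi))" "y\<^sup>2 / 2"]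
      by (simp add: log_density_def)
    also have "\<dots> \<le> (\<bar>ln (2 / sqrt (2 * pi))\<bar> + 1) * (1 + y\<^sup>2)"
      by (simp add: algebra_simps)
    finally have *: "\<bar>log_density (0, 1) y\<bar> \<le> (\<bar>ln (2 / sqrt (2 * pi))\<bar> + 1) * (1 + y\<^sup>2)" .
    have "(\<bar>ln (2 / sqrt (2 * pi))\<bar> + 1 + log_density_gap \<theta> (0, 1)) * (1 + y\<^sup>2) =
      (\<bar>ln (2 / sqrt (2 * pi))\<bar> + 1) * (1 + y\<^sup>2) + (1 + y\<^sup>2) * log_density_gap \<theta> (0, 1)"
      by (simp add: algebra_simps)
    with * show ?thesis
      using log_density_diff_le[of \<theta> y "(0, 1)"] by linarith
  qed
  then show ?thesis by blast
qed

lemma continuous_on_log_density: "continuous_on UNIV (log_density \<theta>)"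
proof (cases \<theta>)
  case (Pair \<mu> \<sigma>)
  show ?thesis
    unfolding Pair log_density_def prod.case divide_inverse by (intro continuous_intros)
qed

lemma continuous_on_log_density_param: "continuous_on param_space (\<lambda>\<theta>. log_density \<theta> y)"
  unfolding log_density_def param_space_def split_beta
  by (intro continuous_intros) auto

section \<open>Identifiability up to sign\<close>

lemma log_density_eqD:
  assumes "\<theta> \<in> param_space" "\<theta>' \<in> param_space"
    and eq: "\<And>y. 0 \<le> y \<Longrightarrow> log_density \<theta> y = log_density \<theta>' y"
  shows "orbit_dist \<theta> \<theta>' = 0"
proof -
  obtain \<mu> \<sigma> \<mu>' \<sigma>' where p: "\<theta> = (\<mu>, \<sigma>)" "\<theta>' = (\<mu>', \<sigma>')"
    by (cases \<theta>, cases \<theta>')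
  then have pos: "\<sigma> > 0" "\<sigma>' > 0"
    using assms by (auto simp: param_space_def)
  \<comment> \<open>Since \<open>lncosh\<close> lies between 0 and the absolute value, its term
    grows at most linearly and disappears after division by \<open>y\<^sup>2\<close>.\<close>
  have lim: "((\<lambda>y. log_density (m, s) y / y\<^sup>2) \<longlongrightarrow> - (1 / (2 * s\<^sup>2))) at_top" if "s > 0" for m s
  proof (rule tendsto_sandwich)
    define K where "K = ln (2 / sqrt (2 * pi)) - ln s - m\<^sup>2 / (2 * s\<^sup>2)"
    have dec: "log_density (m, s) y / y\<^sup>2 =
        - (1 / (2 * s\<^sup>2)) + K * (1 / y\<^sup>2) + lncosh (y * m / s\<^sup>2) / y\<^sup>2" if "y > 0" for y
    proof -
      have "log_density (m, s) y = - (y\<^sup>2 * (1 / (2 * s\<^sup>2))) + K + lncosh (y * m / s\<^sup>2)"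
        by (simp add: log_density_def K_def add_divide_distrib)
      then show ?thesis
        using that by (simp only: add_divide_distrib minus_divide_left[symmetric]) simp
    qed
    show "\<forall>\<^sub>F y in at_top. - (1 / (2 * s\<^sup>2)) + K * (1 / y\<^sup>2) \<le> log_density (m, s) y / y\<^sup>2"
      using eventually_gt_at_top[of 0]
    proof eventually_elim
      case (elim y)
      then show ?case using lncosh_nonneg[of "y * m / s\<^sup>2"] by (simp add: dec)
    qed
    show "\<forall>\<^sub>F y in at_top. log_density (m, s) y / y\<^sup>2 \<le>
        - (1 / (2 * s\<^sup>2)) + K * (1 / y\<^sup>2) + \<bar>m / s\<^sup>2\<bar> * (1 / y)"
      using eventually_gt_at_top[of 0]
    proof eventually_elim
      case (elim y)
      have "lncosh (y * m / s\<^sup>2) / y\<^sup>2 \<le> \<bar>y * m / s\<^sup>2\<bar> / y\<^sup>2"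
        by (intro divide_right_mono lncosh_le) auto
      also have "\<dots> = \<bar>m / s\<^sup>2\<bar> * (1 / y)"
        using elim by (simp add: power2_eq_square abs_mult)
      finally show ?case using elim by (simp add: dec)
    qed
    have inv: "((\<lambda>y::real. 1 / y) \<longlongrightarrow> 0) at_top"
      using tendsto_inverse_0_at_top[of "\<lambda>y::real. y", OF filterlim_ident]
      by (simp add: divide_inverse)
    have inv2: "((\<lambda>y::real. 1 / y\<^sup>2) \<longlongrightarrow> 0) at_top"
      using tendsto_mult[OF inv inv] by (simp add: power2_eq_square)
    show "((\<lambda>y. - (1 / (2 * s\<^sup>2)) + K * (1 / y\<^sup>2)) \<longlongrightarrow> - (1 / (2 * s\<^sup>2))) at_top"
      by (rule tendsto_eq_intros inv2 refl)+ simp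
    show "((\<lambda>y. - (1 / (2 * s\<^sup>2)) + K * (1 / y\<^sup>2) + \<bar>m / s\<^sup>2\<bar> * (1 / y)) \<longlongrightarrow> - (1 / (2 * s\<^sup>2))) at_top"
      by (rule tendsto_eq_intros inv inv2 refl)+ simp
  qed
  have ev: "\<forall>\<^sub>F y in at_top. log_density (\<mu>, \<sigma>) y / y\<^sup>2 = log_density (\<mu>', \<sigma>') y / y\<^sup>2"
    using eventually_ge_at_top[of 0] by eventually_elim (use eq p in auto)
  have "- (1 / (2 * \<sigma>\<^sup>2)) = - (1 / (2 * \<sigma>'\<^sup>2))"
    using tendsto_unique[OF _ lim[OF pos(1), of \<mu>]
        Lim_transform_eventually[OF lim[OF pos(2), of \<mu>'] eventually_mono[OF ev sym]]]
    by simp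
  then have s: "\<sigma> = \<sigma>'"
    using pos by (simp add: power2_eq_iff_nonneg)
  with eq[of 0] pos p have "\<mu>\<^sup>2 = \<mu>'\<^sup>2"
    by (simp add: log_density_def)
  then have "\<mu> = \<mu>' \<or> \<mu> = - \<mu>'"
    by (simp add: power2_eq_iff)
  with s p show ?thesis
    by (auto simp: orbit_dist_eq min_def)
qed

section \<open>Coercivity of the upper bound for the average log density\<close>

lemma coercive_region_compact:
  fixes v B L :: real
  assumes "v > 0"
  shows "\<exists>K. compact K \<and> K \<subseteq> param_space \<and> (\<forall>\<mu> \<sigma> m s. \<sigma> > 0 \<longrightarrow> v \<le> s \<longrightarrow> \<bar>m\<bar> \<le> B \<longrightarrow>
    L \<le> - ln \<sigma> - (s + (\<bar>\<mu>\<bar> - m)\<^sup>2) / (2 * \<sigma>\<^sup>2) \<longrightarrow> (\<mu>, \<sigma>) \<in> K)"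
proof -
  \<comment> \<open>With \<open>w = 1 / \<sigma>\<close>, the estimate
    \<open>- ln \<sigma> \<le> w\<close> turns the assumption into
    \<open>v * w\<^sup>2 \<le> 2 * (w + \<bar>L\<bar>)\<close>. For \<open>w > 1\<close> the right
    side is at most \<open>2 * (1 + \<bar>L\<bar>) * w\<close>, which gives the second entry of the
    maximum; the entry 1 covers \<open>w \<le> 1\<close>.\<close>
  define u where "u = max 1 (2 * (1 + \<bar>L\<bar>) / v)"
  \<comment> \<open>Dropping the nonnegative quotient leaves
    \<open>L \<le> - ln \<sigma>\<close>.\<close>
  define b where "b = exp (- L)"
  \<comment> \<open>The bounds on \<open>\<sigma>\<close> and \<open>w\<close> control the square of
    \<open>\<bar>\<mu>\<bar> - m\<close>; the inequality
    \<open>\<bar>x\<bar> \<le> 1 + x\<^sup>2\<close> then replaces a square root.\<close>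
  define R where "R = B + 1 + 2 * b\<^sup>2 * (u + \<bar>L\<bar>)"
  have u: "u \<ge> 1" "u > 0" by (auto simp: u_def)
  show ?thesis
  proof (intro exI[of _ "{-R..R} \<times> {1 / u..b}"] conjI allI impI)
    show "compact ({-R..R} \<times> {1 / u..b})"
      by (intro compact_Times compact_Icc)
    show "{-R..R} \<times> {1 / u..b} \<subseteq> param_space"
      using u by (auto simp: param_space_def intro: less_le_trans[of 0 "1 / u"])
    fix \<mu> \<sigma> m s :: real
    assume \<sigma>: "\<sigma> > 0" and s: "v \<le> s" and m: "\<bar>m\<bar> \<le> B"
      and L: "L \<le> - ln \<sigma> - (s + (\<bar>\<mu>\<bar> - m)\<^sup>2) / (2 * \<sigma>\<^sup>2)"
    have "0 \<le> (s + (\<bar>\<mu>\<bar> - m)\<^sup>2) / (2 * \<sigma>\<^sup>2)"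
      using s assms by (intro divide_nonneg_nonneg add_nonneg_nonneg) auto
    then have "ln \<sigma> \<le> - L"
      using L by linarith
    then have "\<sigma> \<le> b"
      using \<sigma> by (simp add: b_def ln_le_cancel_iff[symmetric])
    define w where "w = 1 / \<sigma>"
    have w: "w > 0" using \<sigma> by (simp add: w_def)
    have lnw: "- ln \<sigma> \<le> w"
      using ln_le_minus_one[OF w] \<sigma> by (simp add: w_def ln_div)
    have L': "L \<le> w - (s + (\<bar>\<mu>\<bar> - m)\<^sup>2) * w\<^sup>2 / 2"
      using L lnw by (simp add: w_def power_divide)
    have "w \<le> u"
    proof (cases "w \<le> 1")
      case False
      have "v * w\<^sup>2 \<le> (s + (\<bar>\<mu>\<bar> - m)\<^sup>2) * w\<^sup>2"
        using s by (intro mult_right_mono) (auto simp: add_increasing2)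
      then have "v * w\<^sup>2 \<le> 2 * (w + \<bar>L\<bar>)"
        using L' by (simp add: abs_if split: if_splits)
      also have "\<dots> \<le> 2 * (1 + \<bar>L\<bar>) * w"
        using False mult_left_mono[of 1 w "\<bar>L\<bar>"] by (simp add: algebra_simps)
      finally have "v * w \<le> 2 * (1 + \<bar>L\<bar>)"
        using w by (simp add: power2_eq_square)
      then have "w \<le> 2 * (1 + \<bar>L\<bar>) / v"
        using assms by (simp add: field_simps)
      then show ?thesis by (simp add: u_def)
    qed (use u in auto)
    then have "1 / u \<le> \<sigma>"
      using \<sigma> u by (simp add: w_def field_simps)
    have "(\<bar>\<mu>\<bar> - m)\<^sup>2 / (2 * \<sigma>\<^sup>2) \<le> (s + (\<bar>\<mu>\<bar> - m)\<^sup>2) / (2 * \<sigma>\<^sup>2)"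
      using s assms by (intro divide_right_mono) auto
    also have "\<dots> \<le> u + \<bar>L\<bar>"
      using L lnw \<open>w \<le> u\<close> by linarith
    finally have "(\<bar>\<mu>\<bar> - m)\<^sup>2 \<le> 2 * \<sigma>\<^sup>2 * (u + \<bar>L\<bar>)"
      using \<sigma> by (simp add: field_simps)
    also have "\<dots> \<le> 2 * b\<^sup>2 * (u + \<bar>L\<bar>)"
      using \<sigma> \<open>\<sigma> \<le> b\<close> u by (intro mult_right_mono mult_left_mono power_mono) auto
    finally have "\<bar>\<bar>\<mu>\<bar> - m\<bar> \<le> 1 + 2 * b\<^sup>2 * (u + \<bar>L\<bar>)"
      using abs_le_1_plus_square[of "\<bar>\<mu>\<bar> - m"] by simp
    then have "\<bar>\<mu>\<bar> \<le> R"
      using m unfolding R_def by linarith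
    then show "(\<mu>, \<sigma>) \<in> {-R..R} \<times> {1 / u..b}"
      using \<open>\<sigma> \<le> b\<close> \<open>1 / u \<le> \<sigma>\<close> by (auto simp: abs_le_iff)
  qed
qed

section \<open>Sample averages\<close>

definition avg :: "(nat \<Rightarrow> real) \<Rightarrow> nat \<Rightarrow> real" where
  "avg x n = (\<Sum>i<n. x i) / real n"

abbreviation avg_log_density :: "(nat \<Rightarrow> real) \<Rightarrow> nat \<Rightarrow> real \<times> real \<Rightarrow> real" where
  "avg_log_density y n \<theta> \<equiv> avg (\<lambda>i. log_density \<theta> (y i)) n"

abbreviation sample_variance :: "(nat \<Rightarrow> real) \<Rightarrow> nat \<Rightarrow> real" where
  "sample_variance y n \<equiv> avg (\<lambda>i. (y i)\<^sup>2) n - (avg y n)\<^sup>2"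

lemma avg_mono: "(\<And>i. i < n \<Longrightarrow> x i \<le> z i) \<Longrightarrow> avg x n \<le> avg z n"
  unfolding avg_def by (intro divide_right_mono sum_mono) auto

lemma avg_add: "avg (\<lambda>i. x i + z i) n = avg x n + avg z n"
  by (simp add: avg_def sum.distrib add_divide_distrib)

lemma avg_diff: "avg (\<lambda>i. x i - z i) n = avg x n - avg z n"
  by (simp add: avg_def sum_subtractf diff_divide_distrib)

lemma avg_multc: "avg (\<lambda>i. x i * c) n = avg x n * c"
  by (simp add: avg_def sum_distrib_right)

lemma avg_divide: "avg (\<lambda>i. x i / c) n = avg x n / c"
  by (simp add: avg_def sum_divide_distrib mult.commute)

lemma avg_const: "n > 0 \<Longrightarrow> avg (\<lambda>i. c) n = c"
  by (simp add: avg_def)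

lemma abs_avg_le: "\<bar>avg x n\<bar> \<le> avg (\<lambda>i. \<bar>x i\<bar>) n"
  unfolding avg_def by (simp add: divide_right_mono)

text \<open>Bias-variance decomposition. With \<open>a = \<bar>\<mu>\<bar>\<close> it produces the
  coercive bound, with \<open>a = avg y n\<close> the positivity of the sample variance.\<close>

lemma avg_square_deviation:
  assumes "n > 0"
  shows "avg (\<lambda>i. (y i - a)\<^sup>2) n = sample_variance y n + (a - avg y n)\<^sup>2"
proof -
  have "avg (\<lambda>i. (y i - a)\<^sup>2) n = avg (\<lambda>i. (y i)\<^sup>2 - y i * (2 * a) + a\<^sup>2) n"
    by (simp add: power2_diff algebra_simps)
  also have "\<dots> = avg (\<lambda>i. (y i)\<^sup>2) n - avg y n * (2 * a) + a\<^sup>2"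
    using assms by (simp only: avg_add avg_diff avg_multc avg_const)
  finally show ?thesis by (simp add: power2_diff)
qed

lemma avg_log_density_le:
  assumes "n > 0" "\<And>i. i < n \<Longrightarrow> 0 \<le> y i" "\<sigma> > 0"
  shows "avg_log_density y n (\<mu>, \<sigma>) \<le>
    - ln \<sigma> - (sample_variance y n + (\<bar>\<mu>\<bar> - avg y n)\<^sup>2) / (2 * \<sigma>\<^sup>2)"
proof -
  have "avg_log_density y n (\<mu>, \<sigma>) \<le> avg (\<lambda>i. - ln \<sigma> - (y i - \<bar>\<mu>\<bar>)\<^sup>2 / (2 * \<sigma>\<^sup>2)) n"
    using assms by (intro avg_mono log_density_le) auto
  also have "\<dots> = - ln \<sigma> - avg (\<lambda>i. (y i - \<bar>\<mu>\<bar>)\<^sup>2) n / (2 * \<sigma>\<^sup>2)"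
    using assms by (simp only: avg_diff avg_const avg_divide)
  finally show ?thesis using assms by (simp add: avg_square_deviation)
qed

lemma avg_log_density_diff_le:
  assumes "n > 0"
  shows "\<bar>avg_log_density y n \<theta> - avg_log_density y n \<theta>'\<bar> \<le>
    (1 + avg (\<lambda>i. (y i)\<^sup>2) n) * log_density_gap \<theta> \<theta>'"
proof -
  have "\<bar>avg_log_density y n \<theta> - avg_log_density y n \<theta>'\<bar> \<le>
      avg (\<lambda>i. \<bar>log_density \<theta> (y i) - log_density \<theta>' (y i)\<bar>) n"
    unfolding avg_diff[symmetric] by (rule abs_avg_le)
  also have "\<dots> \<le> avg (\<lambda>i. (1 + (y i)\<^sup>2) * log_density_gap \<theta> \<theta>') n"
    by (intro avg_mono log_density_diff_le)
  also have "\<dots> = (1 + avg (\<lambda>i. (y i)\<^sup>2) n) * log_density_gap \<theta> \<theta>'"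
    using assms by (simp only: avg_multc avg_add avg_const)
  finally show ?thesis .
qed

section \<open>The MLE set of a fixed sample\<close>

lemma continuous_on_avg_log_density: "continuous_on param_space (avg_log_density y n)"
  unfolding avg_def divide_inverse by (intro continuous_intros continuous_on_log_density_param)

text \<open>On the parameter space the log likelihood of a nonnegative sample is \<open>n\<close>
  times the average, and a positive factor does not move maximisers.\<close>

lemma mle_set_eq:
  assumes "n > 0" "\<And>i. i < n \<Longrightarrow> 0 \<le> y i"
  shows "mle_set y n = {\<theta> \<in> param_space.
    \<forall>\<theta>'\<in>param_space. avg_log_density y n \<theta>' \<le> avg_log_density y n \<theta>}"
proof -
  have "log_likelihood y n \<theta> = real n * avg_log_density y n \<theta>" if "\<theta> \<in> param_space" for \<theta>
    using assms that by (simp add: log_likelihood_def avg_def ln_folded_normal_density)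
  then show ?thesis
    using assms by (auto simp: mle_set_def is_arg_max_def not_less)
qed

lemma sample_variance_pos:
  assumes "i < n" "y i \<noteq> y 0"
  shows "sample_variance y n > 0"
proof -
  have n: "n > 0" using assms by auto
  have "(\<Sum>j<n. (y j - avg y n)\<^sup>2) > 0"
  proof (rule ccontr)
    assume "\<not> ?thesis"
    then have "(\<Sum>j<n. (y j - avg y n)\<^sup>2) = 0"
      by (simp add: sum_nonneg antisym not_less)
    then have "\<forall>j<n. y j = avg y n"
      by (simp add: sum_nonneg_eq_0_iff)
    with assms n show False by metis
  qed
  then have "avg (\<lambda>j. (y j - avg y n)\<^sup>2) n > 0"
    using n by (simp add: avg_def)
  then show ?thesis
    using n by (simp add: avg_square_deviation)
qed

text \<open>Here \<open>K\<close> may depend on the sample, so the coercivity bound is used with the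
  sample's own variance and mean.\<close>

lemma avg_log_density_superlevel_compact:
  assumes n: "n > 0" and y: "\<And>i. i < n \<Longrightarrow> 0 \<le> y i" and v: "sample_variance y n > 0"
  shows "\<exists>K. compact K \<and> K \<subseteq> param_space \<and>
    (\<forall>\<theta>\<in>param_space. L \<le> avg_log_density y n \<theta> \<longrightarrow> \<theta> \<in> K)"
proof -
  obtain K where K: "compact K" "K \<subseteq> param_space" and
    *: "\<And>\<mu> \<sigma> m s. \<sigma> > 0 \<Longrightarrow> sample_variance y n \<le> s \<Longrightarrow> \<bar>m\<bar> \<le> \<bar>avg y n\<bar> \<Longrightarrow>
    L \<le> - ln \<sigma> - (s + (\<bar>\<mu>\<bar> - m)\<^sup>2) / (2 * \<sigma>\<^sup>2) \<Longrightarrow> (\<mu>, \<sigma>) \<in> K"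
    using coercive_region_compact[OF v, of "\<bar>avg y n\<bar>" L] by blast
  have "\<theta> \<in> K" if "\<theta> \<in> param_space" "L \<le> avg_log_density y n \<theta>" for \<theta>
  proof (cases \<theta>)
    case (Pair \<mu> \<sigma>)
    with that have "\<sigma> > 0" by (simp add: param_space_def)
    then show ?thesis
      using that avg_log_density_le[of n y \<sigma> \<mu>] n y
      unfolding Pair by (intro * order_refl) auto
  qed
  with K show ?thesis by blast
qed

lemma mle_set_nonempty:
  assumes n: "n > 0" and y: "\<And>i. i < n \<Longrightarrow> 0 \<le> y i" and v: "sample_variance y n > 0"
  shows "mle_set y n \<noteq> {}"
proof -
  let ?l = "avg_log_density y n"
  \<comment> \<open>Any parameter would do as a reference: its level makes the superlevel set
    nonempty, and outside \<open>K\<close> the average stays below that level, so a maximiser over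
    \<open>K\<close> is global.\<close>
  have p: "(0, 1) \<in> param_space" by (simp add: param_space_def)
  obtain K where K: "compact K" "K \<subseteq> param_space"
    and *: "\<And>\<theta>. \<theta> \<in> param_space \<Longrightarrow> ?l (0, 1) \<le> ?l \<theta> \<Longrightarrow> \<theta> \<in> K"
    using avg_log_density_superlevel_compact[OF n y v, of "?l (0, 1)"] by blast
  have "(0, 1) \<in> K" using *[OF p] by simp
  then obtain \<theta> where \<theta>: "\<theta> \<in> K" "\<And>\<theta>'. \<theta>' \<in> K \<Longrightarrow> ?l \<theta>' \<le> ?l \<theta>"
    using continuous_attains_sup[OF K(1), of ?l]
      continuous_on_subset[OF continuous_on_avg_log_density K(2)] by blast
  have "?l \<theta>' \<le> ?l \<theta>" if "\<theta>' \<in> param_space" for \<theta>'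
  proof (cases "?l (0, 1) \<le> ?l \<theta>'")
    case True
    then show ?thesis using * \<theta>(2) that by blast
  next
    case False
    then show ?thesis using \<theta>(2)[OF \<open>(0, 1) \<in> K\<close>] by linarith
  qed
  then have "\<theta> \<in> mle_set y n"
    using \<theta>(1) K(2) n y by (auto simp: mle_set_eq)
  then show ?thesis by blast
qed

text \<open>Keeps one of the two Gaussian terms, evaluated at its centre. The bound tends to
  infinity as \<open>\<sigma>\<close> tends to 0.\<close>

lemma log_density_self_ge: "- ln \<sigma> + ln (1 / sqrt (2 * pi)) \<le> log_density (y, \<sigma>) y"
  if "\<sigma> > 0" "0 \<le> y" for y \<sigma> :: real
proof -
  have "0 \<le> normal_density (- y) \<sigma> y" by (rule normal_density_nonneg)
  then have "normal_density y \<sigma> y \<le> exp (log_density (y, \<sigma>) y)"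
    using that exp_log_density[of \<sigma> y y]
    by (simp add: folded_normal_density_altdef del: normal_density_nonneg)
  then have "ln (1 / sqrt (2 * pi) / \<sigma>) \<le> log_density (y, \<sigma>) y"
    using that by (simp add: normal_density_def real_sqrt_mult ln_ge_iff[symmetric] ln_le_cancel_iff[symmetric])
  then show ?thesis
    using that by (simp add: ln_div ln_mult)
qed

text \<open>With \<open>\<mu> = a\<close> and \<open>\<sigma>\<close> tending to 0 the likelihood is
  unbounded. Every nonnegative sample of size 1 is of this kind, which is why selections are
  considered from \<open>n = 2\<close> on.\<close>

lemma mle_set_constant_sample:
  assumes n: "n > 0" and y: "\<And>i. i < n \<Longrightarrow> y i = a" "0 \<le> a"
  shows "mle_set y n = {}"
proof -
  have avg: "avg_log_density y n \<theta> = log_density \<theta> a" for \<theta>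
    using n y by (simp add: avg_def)
  have "\<exists>\<theta>'\<in>param_space. \<not> log_density \<theta>' a \<le> C" for C
  proof (intro bexI)
    \<comment> \<open>Solves \<open>- ln s + ln (1 / sqrt (2 * pi)) = C + 1\<close>.\<close>
    define s where "s = exp (ln (1 / sqrt (2 * pi)) - C - 1)"
    have s: "s > 0" "ln s = ln (1 / sqrt (2 * pi)) - C - 1"
      by (simp_all add: s_def)
    show "\<not> log_density (a, s) a \<le> C"
      using log_density_self_ge[OF s(1) y(2)] s(2) by linarith
    show "(a, s) \<in> param_space"
      using s by (simp add: param_space_def)
  qed
  then show ?thesis
    using n y by (subst mle_set_eq) (auto simp: avg)
qed

section \<open>Reduction to countably many parameters\<close>

lemma continuous_on_orbit_dist: "continuous_on A (\<lambda>\<theta>. orbit_dist \<theta> \<theta>')"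
  unfolding orbit_dist_def by (intro continuous_intros)

text \<open>The right-hand side involves only countably many parameters, so that it defines a measurable
  event when \<open>y\<close> is random.\<close>

lemma ex_mle_orbit_dist_gt_iff:
  fixes c :: real
  assumes n: "n > 0" and y: "\<And>i. i < n \<Longrightarrow> 0 \<le> y i" and v: "sample_variance y n > 0"
    and D: "D \<subseteq> param_space"
    and dense: "\<And>U. open U \<Longrightarrow> U \<subseteq> param_space \<Longrightarrow> U \<noteq> {} \<Longrightarrow> \<exists>d\<in>D. d \<in> U"
  shows "(\<exists>\<theta>\<in>mle_set y n. c < orbit_dist \<theta> \<theta>\<^sub>0) \<longleftrightarrow>
    (\<exists>c'::rat. c < of_rat c' \<and> (\<forall>k::nat. \<forall>q\<in>D. \<exists>r\<in>D. of_rat c' < orbit_dist r \<theta>\<^sub>0 \<and>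
      avg_log_density y n q - 1 / Suc k < avg_log_density y n r))"
  (is "?L \<longleftrightarrow> ?R")
proof
  let ?l = "avg_log_density y n" and ?d = "\<lambda>\<theta>. orbit_dist \<theta> \<theta>\<^sub>0"
  have op: "open param_space"
    by (simp add: param_space_def open_Times)
  have contl: "isCont ?l \<theta>" if "\<theta> \<in> param_space" for \<theta>
    using continuous_on_avg_log_density that op by (simp add: continuous_on_eq_continuous_at)
  have near: "\<exists>r\<in>D. P r" if "\<theta> \<in> param_space" "\<forall>\<^sub>F r in nhds \<theta>. P r" for P \<theta>
  proof -
    obtain S where "open S" "\<theta> \<in> S" "\<And>r. r \<in> S \<Longrightarrow> P r"
      using \<open>\<forall>\<^sub>F r in nhds \<theta>. P r\<close> by (auto simp: eventually_nhds)
    then show ?thesis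
      using dense[of "S \<inter> param_space"] op that by blast
  qed
  have contl_nhds: "\<forall>\<^sub>F r in nhds \<theta>. a < ?l r" if "\<theta> \<in> param_space" "a < ?l \<theta>" for \<theta> a
    using order_tendstoD(1)[OF tendsto_at_iff_tendsto_nhds[THEN iffD1, OF contl[unfolded isCont_def]]] that
    by blast
  have contd_nhds: "\<forall>\<^sub>F r in nhds \<theta>. a < ?d r" if "a < ?d \<theta>" for \<theta> a
  proof -
    have "isCont ?d \<theta>"
      using continuous_on_orbit_dist[of UNIV \<theta>\<^sub>0] continuous_on_eq_continuous_at[OF open_UNIV] by blast
    then show ?thesis
      using order_tendstoD(1)[OF tendsto_at_iff_tendsto_nhds[THEN iffD1]] that
      unfolding isCont_def by blast
  qed
  show ?R if ?L
  proof -
    obtain \<theta> where \<theta>: "\<theta> \<in> param_space" "c < ?d \<theta>" and max: "\<And>\<theta>'. \<theta>' \<in> param_space \<Longrightarrow> ?l \<theta>' \<le> ?l \<theta>"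
      using \<open>?L\<close> n y by (auto simp: mle_set_eq)
    \<comment> \<open>The rational number leaves room on both sides. In this direction the strict
      inequality is an open condition and passes to nearby points of \<open>D\<close>; in the
      converse direction only \<open>of_rat c' \<le> ?d \<theta>'\<close> survives the limit, which
      still gives a distance above \<open>c\<close>.\<close>
    obtain c' where c': "c < of_rat c'" "of_rat c' < ?d \<theta>"
      using of_rat_dense[OF \<theta>(2)] by blast
    show ?R
    proof (intro exI[of _ c'] conjI allI ballI)
      fix k :: nat and q assume "q \<in> D"
      then have "?l q \<le> ?l \<theta>"
        using max D by blast
      moreover have "0 < 1 / real (Suc k)"
        by simp
      ultimately have "?l q - 1 / Suc k < ?l \<theta>"
        by linarith
      then show "\<exists>r\<in>D. of_rat c' < ?d r \<and> ?l q - 1 / Suc k < ?l r"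
        using contl_nhds[OF \<theta>(1)] contd_nhds[OF c'(2)] by (intro near[OF \<theta>(1)] eventually_conj)
    qed (use c' in auto)
  qed
  show ?L if ?R
  proof -
    obtain c' :: rat where c': "c < of_rat c'" and
      approx: "\<And>k q. q \<in> D \<Longrightarrow> \<exists>r\<in>D. of_rat c' < ?d r \<and> ?l q - 1 / Suc k < ?l r"
      using \<open>?R\<close> by blast
    obtain \<theta> where "\<theta> \<in> mle_set y n"
      using mle_set_nonempty[OF n y v] by blast
    then have \<theta>: "\<theta> \<in> param_space" and max: "\<And>\<theta>'. \<theta>' \<in> param_space \<Longrightarrow> ?l \<theta>' \<le> ?l \<theta>"
      using n y by (auto simp: mle_set_eq)
    \<comment> \<open>The approximants below lose \<open>1 / Suc k\<close> in replacing
      \<open>\<theta>\<close> by a point \<open>q\<close> of \<open>D\<close>, and the same again in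
      passing from \<open>q\<close> to \<open>r\<close>. Their values thus exceed
      \<open>?l \<theta> - 2\<close> for every \<open>k\<close>, and one compact set contains them
      all.\<close>
    obtain K where K: "compact K" "K \<subseteq> param_space"
      and K': "\<And>\<theta>'. \<theta>' \<in> param_space \<Longrightarrow> ?l \<theta> - 2 \<le> ?l \<theta>' \<Longrightarrow> \<theta>' \<in> K"
      using avg_log_density_superlevel_compact[OF n y v, of "?l \<theta> - 2"] by blast
    have approx': "\<exists>r\<in>K \<inter> {r. of_rat c' \<le> ?d r}. ?l \<theta> - 2 / Suc k < ?l r" for k
    proof -
      have "\<exists>q\<in>D. ?l \<theta> - 1 / Suc k < ?l q"
        using contl_nhds[OF \<theta>] by (intro near[OF \<theta>]) auto
      then obtain q where q: "q \<in> D" "?l \<theta> - 1 / Suc k < ?l q" by blast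
      obtain r where r: "r \<in> D" "of_rat c' < ?d r" "?l q - 1 / Suc k < ?l r"
        using approx[OF q(1)] by blast
      have "?l \<theta> - 2 / Suc k < ?l r"
        using q r by (simp add: field_simps)
      moreover have "2 / real (Suc k) \<le> 2"
        by (simp add: field_simps)
      ultimately show ?thesis
        using K'[of r] D r by (intro bexI[of _ r]) auto
    qed
    have "closed {r. of_rat c' \<le> ?d r}"
      using continuous_on_orbit_dist[of UNIV \<theta>\<^sub>0]
      by (intro closed_Collect_le continuous_intros)
    then have "compact (K \<inter> {r. of_rat c' \<le> ?d r})"
      using K(1) by (simp add: compact_Int_closed)
    moreover have "K \<inter> {r. of_rat c' \<le> ?d r} \<noteq> {}"
      using approx' by blast
    moreover have "continuous_on (K \<inter> {r. of_rat c' \<le> ?d r}) ?l"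
      using K(2) by (intro continuous_on_subset[OF continuous_on_avg_log_density]) auto
    ultimately obtain \<theta>' where \<theta>': "\<theta>' \<in> K" "of_rat c' \<le> ?d \<theta>'"
      and max': "\<And>r. r \<in> K \<Longrightarrow> of_rat c' \<le> ?d r \<Longrightarrow> ?l r \<le> ?l \<theta>'"
      using continuous_attains_sup[of "K \<inter> {r. of_rat c' \<le> ?d r}" ?l] by auto
    \<comment> \<open>As \<open>k\<close> grows, the maximum over the part of \<open>K\<close> with
      distance at least \<open>c'\<close> reaches the global maximum, so the maximiser found there
      belongs to the MLE set.\<close>
    have "?l \<theta> - 2 / Suc k \<le> ?l \<theta>'" for k
      using approx'[of k] max' by force
    moreover have "(\<lambda>k. ?l \<theta> - 2 / Suc k) \<longlonglongrightarrow> ?l \<theta> - 0"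
      by (intro tendsto_diff tendsto_const LIMSEQ_Suc lim_const_over_n)
    ultimately have "?l \<theta> \<le> ?l \<theta>'"
      using LIMSEQ_le_const2[of "\<lambda>k. ?l \<theta> - 2 / Suc k" "?l \<theta>" "?l \<theta>'"] by simp
    then have "\<theta>' \<in> mle_set y n"
      using n y max \<theta>' K(2) by (auto simp: mle_set_eq intro: order_trans)
    then show ?L
      using \<theta>'(2) c' by (intro bexI[of _ \<theta>']) auto
  qed
qed

section \<open>Moments and total mass of the folded normal law\<close>

lemma measurable_folded_normal_density [measurable]:
  "folded_normal_density \<theta> \<in> borel_measurable borel"
  unfolding folded_normal_density_def by (cases \<theta>) simp

lemma folded_normal_density_nonneg: "\<theta> \<in> param_space \<Longrightarrow> 0 \<le> folded_normal_density \<theta> y"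
  by (auto simp: param_space_def folded_normal_density_altdef)

lemma integrable_normal_density_quartic:
  assumes "\<sigma> > 0"
  shows "integrable lborel (\<lambda>y. normal_density \<mu> \<sigma> y * (1 + y ^ 4))"
proof -
  \<comment> \<open>Binomial expansion of \<open>y ^ 4\<close> about \<open>\<mu>\<close>, because
    the available moments are central ones.\<close>
  have "normal_density \<mu> \<sigma> y * (1 + y ^ 4) =
      (1 + \<mu> ^ 4) * (normal_density \<mu> \<sigma> y * (y - \<mu>) ^ 0) +
      4 * \<mu> ^ 3 * (normal_density \<mu> \<sigma> y * (y - \<mu>) ^ 1) +
      6 * \<mu> ^ 2 * (normal_density \<mu> \<sigma> y * (y - \<mu>) ^ 2) +
      4 * \<mu> * (normal_density \<mu> \<sigma> y * (y - \<mu>) ^ 3) +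
      normal_density \<mu> \<sigma> y * (y - \<mu>) ^ 4" for y
    by (simp add: eval_nat_numeral algebra_simps)
  then show ?thesis
    by (simp only:) (intro Bochner_Integration.integrable_add
        Bochner_Integration.integrable_mult_right integrable_normal_moment assms)
qed

lemma integrable_folded_normal_density_quartic:
  assumes "\<theta> \<in> param_space"
  shows "integrable lborel (\<lambda>y. folded_normal_density \<theta> y * (1 + y ^ 4))"
proof -
  obtain \<mu> \<sigma> where \<theta>: "\<theta> = (\<mu>, \<sigma>)" by (cases \<theta>)
  with assms have \<sigma>: "\<sigma> > 0" by (simp add: param_space_def)
  have "integrable lborel (\<lambda>y. indicator {0..} y *\<^sub>R (normal_density \<mu> \<sigma> y * (1 + y ^ 4) +
      normal_density (- \<mu>) \<sigma> y * (1 + y ^ 4)))"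
    using \<sigma> by (intro integrable_mult_indicator Bochner_Integration.integrable_add
        integrable_normal_density_quartic) auto
  then show ?thesis
    using \<sigma> by (simp add: \<theta> folded_normal_density_altdef algebra_simps)
qed

lemma integrable_folded_normal_density_bounded:
  fixes \<phi> :: "real \<Rightarrow> real"
  assumes "\<theta> \<in> param_space" and [measurable]: "\<phi> \<in> borel_measurable borel"
    and "\<And>y. \<bar>\<phi> y\<bar> \<le> C * (1 + y ^ 4)"
  shows "integrable lborel (\<lambda>y. folded_normal_density \<theta> y * \<phi> y)"
proof (rule Bochner_Integration.integrable_bound)
  show "integrable lborel (\<lambda>y. C * (folded_normal_density \<theta> y * (1 + y ^ 4)))"
    using assms by (intro integrable_mult_right integrable_folded_normal_density_quartic)
  have "\<bar>folded_normal_density \<theta> y * \<phi> y\<bar> \<le> \<bar>C * (folded_normal_density \<theta> y * (1 + y ^ 4))\<bar>" for y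
  proof -
    have "\<bar>folded_normal_density \<theta> y * \<phi> y\<bar> \<le> folded_normal_density \<theta> y * (C * (1 + y ^ 4))"
      using assms folded_normal_density_nonneg[OF assms(1)]
      by (simp add: abs_mult mult_left_mono)
    then show ?thesis by (simp add: mult.left_commute)
  qed
  then show "AE y in lborel. norm (folded_normal_density \<theta> y * \<phi> y) \<le>
      norm (C * (folded_normal_density \<theta> y * (1 + y ^ 4)))"
    by simp
qed simp

lemma power2_le_1_plus_power4: "y\<^sup>2 \<le> 1 + y ^ 4" for y :: real
  using abs_le_1_plus_square[of "y\<^sup>2"] by simp

lemma integrable_folded_normal_density_quadratic:
  fixes \<phi> :: "real \<Rightarrow> real"
  assumes \<theta>: "\<theta> \<in> param_space" and [measurable]: "\<phi> \<in> borel_measurable borel"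
    and \<phi>: "\<And>y. \<bar>\<phi> y\<bar> \<le> C * (1 + y\<^sup>2)"
  shows "integrable lborel (\<lambda>y. folded_normal_density \<theta> y * \<phi> y)"
    and "integrable lborel (\<lambda>y. folded_normal_density \<theta> y * (\<phi> y)\<^sup>2)"
proof -
  have C: "0 \<le> C"
    using \<phi>[of 0] by simp
  have le: "1 + y\<^sup>2 \<le> 2 * (1 + y ^ 4)" "(1 + y\<^sup>2)\<^sup>2 \<le> 3 * (1 + y ^ 4)" for y :: real
  proof -
    \<comment> \<open>Writing \<open>t\<close> for \<open>y ^ 4\<close> makes both inequalities
      linear in \<open>t\<close> and \<open>y\<^sup>2\<close>.\<close>
    have "1 + y\<^sup>2 \<le> 2 * (1 + t)" "1 + 2 * y\<^sup>2 + t \<le> 3 * (1 + t)"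
      if "0 \<le> t" "y\<^sup>2 \<le> 1 + t" for t
      using that by auto
    from this[of "y ^ 4"] show "1 + y\<^sup>2 \<le> 2 * (1 + y ^ 4)" "(1 + y\<^sup>2)\<^sup>2 \<le> 3 * (1 + y ^ 4)"
      using power2_le_1_plus_power4[of y] by (simp_all add: power2_sum)
  qed
  have 1: "\<bar>\<phi> y\<bar> \<le> (2 * C) * (1 + y ^ 4)" for y
    using order_trans[OF \<phi>[of y] mult_left_mono[OF le(1)[of y] C]] by (simp add: ac_simps)
  have 2: "\<bar>(\<phi> y)\<^sup>2\<bar> \<le> (3 * C\<^sup>2) * (1 + y ^ 4)" for y
  proof -
    have "\<bar>(\<phi> y)\<^sup>2\<bar> = \<bar>\<phi> y\<bar>\<^sup>2" by simp
    also have "\<dots> \<le> (C * (1 + y\<^sup>2))\<^sup>2"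
      using \<phi> by (intro power_mono) auto
    also have "\<dots> \<le> C\<^sup>2 * (3 * (1 + y ^ 4))"
      unfolding power_mult_distrib by (intro mult_left_mono le) auto
    finally show ?thesis by (simp add: algebra_simps)
  qed
  show "integrable lborel (\<lambda>y. folded_normal_density \<theta> y * \<phi> y)"
    using 1 by (intro integrable_folded_normal_density_bounded[OF \<theta>]) auto
  show "integrable lborel (\<lambda>y. folded_normal_density \<theta> y * (\<phi> y)\<^sup>2)"
    using 2 by (intro integrable_folded_normal_density_bounded[OF \<theta>, where C = "3 * C\<^sup>2"]) auto
qed

lemma integrable_folded_normal_density:
  "\<theta> \<in> param_space \<Longrightarrow> integrable lborel (folded_normal_density \<theta>)"
  using integrable_folded_normal_density_quadratic(1)[of \<theta> "\<lambda>_. 1" 1] by simp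

text \<open>The reflection of \<open>y\<close> carries the term centred at \<open>- \<mu>\<close> to
  the left half of the normal density centred at \<open>\<mu>\<close>. The two halves cover the line
  and overlap in the null set containing only 0.\<close>

lemma integral_folded_normal_density:
  assumes "\<theta> \<in> param_space"
  shows "(\<integral>y. folded_normal_density \<theta> y \<partial>lborel) = 1"
proof -
  obtain \<mu> \<sigma> where \<theta>: "\<theta> = (\<mu>, \<sigma>)" by (cases \<theta>)
  with assms have \<sigma>: "\<sigma> > 0" by (simp add: param_space_def)
  have int: "integrable lborel (\<lambda>y. indicator A y * normal_density m \<sigma> y)"
    if "A \<in> sets borel" for A m
    using integrable_mult_indicator[of A lborel "normal_density m \<sigma>"] that \<sigma> by simp
  have "(\<integral>y. folded_normal_density \<theta> y \<partial>lborel) =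
      (\<integral>y. indicator {0..} y * normal_density \<mu> \<sigma> y \<partial>lborel) +
      (\<integral>y. indicator {0..} y * normal_density (- \<mu>) \<sigma> y \<partial>lborel)"
    using \<sigma> by (simp add: \<theta> folded_normal_density_altdef distrib_left int)
  also have "(\<integral>y. indicator {0..} y * normal_density (- \<mu>) \<sigma> y \<partial>lborel) =
      (\<integral>y. indicator {..0} y * normal_density \<mu> \<sigma> y \<partial>lborel)"
    by (subst lborel_integral_real_affine[of "- 1" _ 0])
      (auto intro!: Bochner_Integration.integral_cong
        simp: indicator_def normal_density_def power2_commute)
  also have "(\<integral>y. indicator {0..} y * normal_density \<mu> \<sigma> y \<partial>lborel) + \<dots> =
      (\<integral>y. indicator {0..} y * normal_density \<mu> \<sigma> y + indicator {..0} y * normal_density \<mu> \<sigma> y \<partial>lborel)"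
    by (simp add: int)
  also have "\<dots> = (\<integral>y. normal_density \<mu> \<sigma> y \<partial>lborel)"
    by (intro integral_cong_AE) (use AE_lborel_singleton[of 0] in \<open>auto simp: indicator_def\<close>)
  finally show ?thesis using \<sigma> by simp
qed

section \<open>Gibbs' inequality\<close>

lemma AE_lborel_avoids_interval:
  fixes a b :: real
  assumes "AE y in lborel. P y" "\<And>y. a < y \<Longrightarrow> y < b \<Longrightarrow> \<not> P y"
  shows "b \<le> a"
proof (rule ccontr)
  assume "\<not> b \<le> a"
  have "AE y in lborel. y \<notin> {a<..<b}"
    using assms(1) by eventually_elim (use assms(2) in auto)
  then have "{a<..<b} \<in> null_sets lborel"
    by (subst AE_iff_null_sets) auto
  with \<open>\<not> b \<le> a\<close> show False
    by (simp add: null_sets_def)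
qed

text \<open>The density is positive at every \<open>y \<ge> 0\<close>, so the integrand is nonzero
  on an interval of positive length. Serves both Gibbs' inequality and the positivity of the
  population variance.\<close>

lemma integral_folded_normal_density_pos:
  fixes \<phi> :: "real \<Rightarrow> real"
  assumes \<theta>: "\<theta> \<in> param_space" and int: "integrable lborel (\<lambda>y. folded_normal_density \<theta> y * \<phi> y)"
    and nonneg: "\<And>y. 0 \<le> y \<Longrightarrow> 0 \<le> \<phi> y"
    and pos: "0 \<le> a" "a < b" "\<And>y. a < y \<Longrightarrow> y < b \<Longrightarrow> \<phi> y \<noteq> 0"
  shows "0 < (\<integral>y. folded_normal_density \<theta> y * \<phi> y \<partial>lborel)"
proof -
  obtain \<mu> \<sigma> where eq: "\<theta> = (\<mu>, \<sigma>)" by (cases \<theta>)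
  have supp: "folded_normal_density \<theta> y = 0" if "y < 0" for y
    using that by (simp add: eq folded_normal_density_def)
  have ge0: "0 \<le> folded_normal_density \<theta> y * \<phi> y" for y
    using supp nonneg folded_normal_density_nonneg[OF \<theta>] by (cases "0 \<le> y") auto
  have "\<not> (AE y in lborel. folded_normal_density \<theta> y * \<phi> y = 0)"
  proof
    assume "AE y in lborel. folded_normal_density \<theta> y * \<phi> y = 0"
    moreover have "folded_normal_density \<theta> y * \<phi> y \<noteq> 0" if "a < y" "y < b" for y
      using that pos \<theta> exp_log_density[of \<sigma> y \<mu>] by (auto simp: eq param_space_def)
    ultimately have "b \<le> a"
      by (rule AE_lborel_avoids_interval)
    with pos show False by simp
  qed
  then have "(\<integral>y. folded_normal_density \<theta> y * \<phi> y \<partial>lborel) \<noteq> 0"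
    using integral_nonneg_eq_0_iff_AE[OF int] ge0 by simp
  moreover have "0 \<le> (\<integral>y. folded_normal_density \<theta> y * \<phi> y \<partial>lborel)"
    using ge0 by (intro Bochner_Integration.integral_nonneg) auto
  ultimately show ?thesis by simp
qed

lemma integrable_log_density:
  assumes "\<theta>\<^sub>0 \<in> param_space"
  shows "integrable lborel (\<lambda>y. folded_normal_density \<theta>\<^sub>0 y * log_density \<theta> y)"
  using log_density_quadratic_bound[of \<theta>]
    integrable_folded_normal_density_quadratic(1)[OF assms, of "log_density \<theta>"] by auto

text \<open>For the log ratio \<open>d\<close>, the quantity \<open>exp d - 1 - d\<close> is
  nonnegative and vanishes exactly at \<open>d = 0\<close>. Under the true density,
  \<open>exp d - 1\<close> integrates to \<open>1 - 1 = 0\<close>, which leaves the difference of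
  the two means.\<close>

theorem log_density_gibbs:
  assumes \<theta>: "\<theta> \<in> param_space" and \<theta>\<^sub>0: "\<theta>\<^sub>0 \<in> param_space" and ne: "orbit_dist \<theta> \<theta>\<^sub>0 \<noteq> 0"
  shows "(\<integral>y. folded_normal_density \<theta>\<^sub>0 y * log_density \<theta> y \<partial>lborel) <
    (\<integral>y. folded_normal_density \<theta>\<^sub>0 y * log_density \<theta>\<^sub>0 y \<partial>lborel)"
proof -
  define d where "d y = log_density \<theta> y - log_density \<theta>\<^sub>0 y" for y
  obtain \<mu> \<sigma> \<mu>\<^sub>0 \<sigma>\<^sub>0 where eq: "\<theta> = (\<mu>, \<sigma>)" "\<theta>\<^sub>0 = (\<mu>\<^sub>0, \<sigma>\<^sub>0)"
    by (cases \<theta>, cases \<theta>\<^sub>0)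
  with \<theta> \<theta>\<^sub>0 have \<sigma>: "\<sigma> > 0" "\<sigma>\<^sub>0 > 0" by (auto simp: param_space_def)
  have ratio: "folded_normal_density \<theta>\<^sub>0 y * (exp (d y) - 1 - d y) =
      folded_normal_density \<theta> y - folded_normal_density \<theta>\<^sub>0 y -
      (folded_normal_density \<theta>\<^sub>0 y * log_density \<theta> y - folded_normal_density \<theta>\<^sub>0 y * log_density \<theta>\<^sub>0 y)" for y
  proof (cases "0 \<le> y")
    case True
    then have "folded_normal_density \<theta>\<^sub>0 y * exp (d y) = folded_normal_density \<theta> y"
      using \<sigma> by (simp add: eq exp_log_density d_def flip: exp_add)
    then show ?thesis by (simp add: d_def algebra_simps)
  qed (simp add: eq folded_normal_density_def)
  have int: "integrable lborel (\<lambda>y. folded_normal_density \<theta>\<^sub>0 y * (exp (d y) - 1 - d y))"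
    unfolding ratio
    by (intro Bochner_Integration.integrable_diff integrable_folded_normal_density
        integrable_log_density \<theta> \<theta>\<^sub>0)
  \<comment> \<open>Strictness needs more than one point: continuity extends
    \<open>d \<noteq> 0\<close> to an interval to the right of \<open>y\<^sub>0\<close>, inside the
    support.\<close>
  obtain y\<^sub>0 where y\<^sub>0: "0 \<le> y\<^sub>0" "d y\<^sub>0 \<noteq> 0"
    using log_density_eqD[OF \<theta> \<theta>\<^sub>0] ne by (auto simp: d_def)
  have "isCont d y\<^sub>0"
    unfolding d_def using continuous_on_log_density
    by (intro continuous_diff) (auto simp: continuous_on_eq_continuous_at)
  then obtain e where e: "e > 0" "\<And>y. dist y y\<^sub>0 < e \<Longrightarrow> d y \<noteq> 0"
    using continuous_at_avoid[of y\<^sub>0 d 0] y\<^sub>0 by (auto simp: dist_commute)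
  have "0 < (\<integral>y. folded_normal_density \<theta>\<^sub>0 y * (exp (d y) - 1 - d y) \<partial>lborel)"
  proof (rule integral_folded_normal_density_pos[OF \<theta>\<^sub>0 int _ y\<^sub>0(1)])
    show "y\<^sub>0 < y\<^sub>0 + e" using e by simp
    show "0 \<le> exp (d y) - 1 - d y" for y
      using exp_ge_add_one_self[of "d y"] by linarith
    fix y assume "y\<^sub>0 < y" "y < y\<^sub>0 + e"
    then have "d y \<noteq> 0"
      using e(2)[of y] by (simp add: dist_real_def)
    then show "exp (d y) - 1 - d y \<noteq> 0"
      using ln_eq_minus_one[of "exp (d y)"] by auto
  qed
  also have "\<dots> = (\<integral>y. folded_normal_density \<theta>\<^sub>0 y * log_density \<theta>\<^sub>0 y \<partial>lborel) -
      (\<integral>y. folded_normal_density \<theta>\<^sub>0 y * log_density \<theta> y \<partial>lborel)"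
    unfolding ratio
    by (simp add: integrable_folded_normal_density integrable_log_density
        integral_folded_normal_density \<theta> \<theta>\<^sub>0)
  finally show ?thesis by simp
qed

section \<open>Events of probability tending to one\<close>

text \<open>The exceptional events \<open>B n\<close> are part of the definition because \<open>P n\<close> need not be measurable.\<close>

definition (in prob_space) whp :: "(nat \<Rightarrow> 'a \<Rightarrow> bool) \<Rightarrow> bool" where
  "whp P \<longleftrightarrow> (\<exists>B. (\<forall>n. B n \<in> events \<and> (\<forall>\<omega>\<in>space M - B n. P n \<omega>)) \<and> (\<lambda>n. prob (B n)) \<longlonglongrightarrow> 0)"

lemma (in prob_space) whp_conj:
  assumes "whp P" "whp Q"
  shows "whp (\<lambda>n \<omega>. P n \<omega> \<and> Q n \<omega>)"
proof -
  obtain B C where B: "\<And>n. B n \<in> events" "\<And>n. \<forall>\<omega>\<in>space M - B n. P n \<omega>" "(\<lambda>n. prob (B n)) \<longlonglongrightarrow> 0"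
    and C: "\<And>n. C n \<in> events" "\<And>n. \<forall>\<omega>\<in>space M - C n. Q n \<omega>" "(\<lambda>n. prob (C n)) \<longlonglongrightarrow> 0"
    using assms unfolding whp_def by metis
  have "(\<lambda>n. prob (B n \<union> C n)) \<longlonglongrightarrow> 0"
  proof (rule tendsto_sandwich[where f = "\<lambda>_. 0"])
    show "(\<lambda>n. prob (B n) + prob (C n)) \<longlonglongrightarrow> 0"
      using tendsto_add[OF B(3) C(3)] by simp
    show "\<forall>\<^sub>F n in sequentially. prob (B n \<union> C n) \<le> prob (B n) + prob (C n)"
      using B C by (intro always_eventually allI measure_Un_le)
  qed auto
  then show ?thesis
    unfolding whp_def using B C by (intro exI[of _ "\<lambda>n. B n \<union> C n"]) auto
qed

lemma (in prob_space) whp_mono: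
  assumes "whp P" "\<And>n \<omega>. \<omega> \<in> space M \<Longrightarrow> P n \<omega> \<Longrightarrow> Q n \<omega>"
  shows "whp Q"
  using assms unfolding whp_def by (meson DiffD1)

text \<open>For \<open>n < N\<close> the whole space is an admissible exceptional event, as only the
  limit counts.\<close>

lemma (in prob_space) whp_AE:
  assumes "\<And>n. n \<ge> N \<Longrightarrow> AE \<omega> in M. P n \<omega>"
  shows "whp P"
proof -
  have "\<exists>B. B \<in> events \<and> (\<forall>\<omega>\<in>space M - B. P n \<omega>) \<and> (n \<ge> N \<longrightarrow> prob B = 0)" for n
  proof (cases "n \<ge> N")
    case True
    from AE_E[OF assms[OF True]] obtain B where
      "{\<omega> \<in> space M. \<not> P n \<omega>} \<subseteq> B" "emeasure M B = 0" "B \<in> events" .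
    then show ?thesis by (intro exI[of _ B]) (auto simp: measure_def)
  qed auto
  then obtain B where B: "\<And>n. B n \<in> events" "\<And>n. \<forall>\<omega>\<in>space M - B n. P n \<omega>"
    "\<And>n. n \<ge> N \<Longrightarrow> prob (B n) = 0"
    by metis
  have "(\<lambda>n. prob (B n)) \<longlonglongrightarrow> 0"
    using B(3) by (intro tendsto_eventually) (auto simp: eventually_sequentially)
  with B(1,2) show ?thesis unfolding whp_def by blast
qed

lemma (in prob_space) whp_ball_finite:
  assumes "finite F" "\<And>x. x \<in> F \<Longrightarrow> whp (P x)"
  shows "whp (\<lambda>n \<omega>. \<forall>x\<in>F. P x n \<omega>)"
  using assms
proof (induction F)
  case empty
  show ?case by (rule whp_AE[of 0]) simp
next
  case (insert x F)
  then have "whp (\<lambda>n \<omega>. P x n \<omega> \<and> (\<forall>x\<in>F. P x n \<omega>))"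
    by (intro whp_conj) auto
  then show ?case by simp
qed

text \<open>\<open>A n\<close> is contained in the exceptional event \<open>B n\<close>, whose
  measure is the same in \<open>M\<close> and in the completion. The completion appears because the
  Hausdorff events are shown to be measurable there.\<close>

lemma (in prob_space) whp_measure_tendsto_0:
  assumes "whp P" "\<And>n. A n \<in> sets (completion M)" "\<And>n \<omega>. \<omega> \<in> A n \<Longrightarrow> \<not> P n \<omega>"
  shows "(\<lambda>n. measure (completion M) (A n)) \<longlonglongrightarrow> 0"
proof -
  interpret c: prob_space "completion M"
    by (intro prob_spaceI) (simp add: emeasure_space_1)
  obtain B where B: "\<And>n. B n \<in> events" "\<And>n. \<forall>\<omega>\<in>space M - B n. P n \<omega>" "(\<lambda>n. prob (B n)) \<longlonglongrightarrow> 0"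
    using assms(1) unfolding whp_def by metis
  show ?thesis
  proof (rule tendsto_sandwich[where f = "\<lambda>_. 0"])
    have "measure (completion M) (A n) \<le> prob (B n)" for n
    proof -
      have "A n \<subseteq> B n"
        using assms(3)[of _ n] B(2)[of n] sets.sets_into_space[OF assms(2)[of n]] by auto
      then have "measure (completion M) (A n) \<le> measure (completion M) (B n)"
        using B(1) by (intro c.finite_measure_mono) auto
      then show ?thesis using B(1) by simp
    qed
    then show "\<forall>\<^sub>F n in sequentially. measure (completion M) (A n) \<le> prob (B n)" by simp
  qed (use B(3) in auto)
qed

section \<open>Weak law of large numbers\<close>

lemma (in prob_space) expectation_square_sum_centered:
  fixes W :: "nat \<Rightarrow> 'a \<Rightarrow> real"
  assumes indep: "indep_vars (\<lambda>_. borel) W UNIV"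
    and sq: "\<And>i. integrable M (\<lambda>\<omega>. (W i \<omega>)\<^sup>2)"
    and mean: "\<And>i. expectation (W i) = 0"
    and var: "\<And>i. expectation (\<lambda>\<omega>. (W i \<omega>)\<^sup>2) = V"
  shows "integrable M (\<lambda>\<omega>. (\<Sum>i<n. W i \<omega>)\<^sup>2)" (is ?int)
    and "expectation (\<lambda>\<omega>. (\<Sum>i<n. W i \<omega>)\<^sup>2) = real n * V" (is ?eq)
proof -
  have rv [measurable]: "random_variable borel (W i)" for i
    using indep by (simp add: indep_vars_def)
  have int: "integrable M (W i)" for i
    by (rule square_integrable_imp_integrable[OF rv sq])
  \<comment> \<open>Independent centred variables are uncorrelated, so only the \<open>n\<close>
    diagonal terms of the expanded square contribute.\<close>
  have prod: "integrable M (\<lambda>\<omega>. W i \<omega> * W j \<omega>) \<and>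
      expectation (\<lambda>\<omega>. W i \<omega> * W j \<omega>) = (if i = j then V else 0)" for i j
  proof (cases "i = j")
    case True
    then show ?thesis using sq[of i] var[of i] by (simp add: power2_eq_square)
  next
    case False
    have ind: "indep_vars (\<lambda>_. borel) W {i, j}"
      using indep by (rule indep_vars_subset) auto
    show ?thesis
      using indep_vars_lebesgue_integral[OF _ ind int] indep_vars_integrable[OF _ ind int] False mean
      by simp
  qed
  have exp: "(\<Sum>i<n. W i \<omega>)\<^sup>2 = (\<Sum>i<n. \<Sum>j<n. W i \<omega> * W j \<omega>)" for \<omega>
    by (simp add: power2_eq_square sum_product)
  show ?int unfolding exp using prod by (intro Bochner_Integration.integrable_sum) auto
  show ?eq unfolding exp using prod by (simp add: Bochner_Integration.integrable_sum)
qed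

text \<open>Chebyshev's inequality: the deviation of the average has second moment
  \<open>V / n\<close>, where \<open>V\<close> is the common variance.\<close>

theorem (in prob_space) weak_law_of_large_numbers:
  fixes Z :: "nat \<Rightarrow> 'a \<Rightarrow> real"
  assumes indep: "indep_vars (\<lambda>_. borel) Z UNIV"
    and int: "\<And>i. integrable M (Z i)" and sq: "\<And>i. integrable M (\<lambda>\<omega>. (Z i \<omega>)\<^sup>2)"
    and mean: "\<And>i. expectation (Z i) = c" and second: "\<And>i. expectation (\<lambda>\<omega>. (Z i \<omega>)\<^sup>2) = s"
    and \<epsilon>: "\<epsilon> > 0"
  shows "whp (\<lambda>n \<omega>. \<bar>avg (\<lambda>i. Z i \<omega>) n - c\<bar> < \<epsilon>)"
proof -
  define W where "W i \<omega> = Z i \<omega> - c" for i \<omega>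
  define V where "V = s - c\<^sup>2"
  have rv [measurable]: "random_variable borel (Z i)" for i
    using indep by (simp add: indep_vars_def)
  have indepW: "indep_vars (\<lambda>_. borel) W UNIV"
    unfolding W_def by (rule indep_vars_compose2[OF indep]) simp
  have W2: "(W i \<omega>)\<^sup>2 = (Z i \<omega>)\<^sup>2 - 2 * c * Z i \<omega> + c\<^sup>2" for i \<omega>
    by (simp add: W_def power2_diff)
  have meanW: "expectation (W i) = 0" for i
    unfolding W_def using int mean by (simp add: prob_space)
  have sqW: "integrable M (\<lambda>\<omega>. (W i \<omega>)\<^sup>2)" for i
    unfolding W2 using int sq by simp
  have varW: "expectation (\<lambda>\<omega>. (W i \<omega>)\<^sup>2) = V" for i
    unfolding W2 using int sq mean second by (simp add: prob_space V_def power2_eq_square)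
  have [measurable]: "(\<lambda>\<omega>. avg (\<lambda>i. Z i \<omega>) n) \<in> borel_measurable M" for n
    unfolding avg_def by simp
  define B where "B n = {\<omega> \<in> space M. \<epsilon> \<le> \<bar>avg (\<lambda>i. Z i \<omega>) n - c\<bar>}" for n
  have "prob (B n) \<le> V / \<epsilon>\<^sup>2 / n" if n: "n > 0" for n
  proof -
    have "(\<Sum>i<n. W i \<omega>) = real n * (avg (\<lambda>i. Z i \<omega>) n - c)" for \<omega>
      using n by (simp add: W_def avg_def sum_subtractf field_simps)
    then have "B n = {\<omega> \<in> space M. n * \<epsilon> \<le> \<bar>\<Sum>i<n. W i \<omega>\<bar>}"
      using n by (simp add: B_def abs_mult)
    also have "prob \<dots> \<le> expectation (\<lambda>\<omega>. (\<Sum>i<n. W i \<omega>)\<^sup>2) / (n * \<epsilon>)\<^sup>2"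
      using expectation_square_sum_centered(1)[OF indepW sqW meanW varW] n \<epsilon>
      by (intro second_moment_method) (auto simp: W_def)
    also have "\<dots> = V / \<epsilon>\<^sup>2 / n"
      using expectation_square_sum_centered(2)[OF indepW sqW meanW varW] n
      by (simp add: power_mult_distrib power2_eq_square)
    finally show ?thesis .
  qed
  then have le: "\<forall>\<^sub>F n in sequentially. prob (B n) \<le> V / \<epsilon>\<^sup>2 / n"
    by (auto intro: eventually_mono[OF eventually_gt_at_top[of 0]])
  have "(\<lambda>n. prob (B n)) \<longlonglongrightarrow> 0"
    by (rule tendsto_sandwich[OF _ le tendsto_const lim_const_over_n]) simp
  then show ?thesis
    unfolding whp_def by (intro exI[of _ B]) (auto simp: B_def)
qed

section \<open>Hausdorff distance to a single orbit, and measurability up to null sets\<close>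

lemma hausdorff_dist_singleton:
  assumes "0 \<le> c"
  shows "ennreal c < hausdorff_dist quotient_dist (orbit ` A) {orbit \<theta>\<^sub>0} \<longleftrightarrow>
    A = {} \<or> (\<exists>\<theta>\<in>A. c < orbit_dist \<theta> \<theta>\<^sub>0)"
proof -
  have sym: "orbit_dist \<theta>\<^sub>0 \<theta> = orbit_dist \<theta> \<theta>\<^sub>0" for \<theta>
  proof -
    have "\<bar>- a - b\<bar> = \<bar>- b - a\<bar>" "\<bar>a - b\<bar> = \<bar>b - a\<bar>" "\<bar>a + b\<bar> = \<bar>b + a\<bar>" for a b :: real
      by linarith+
    then show ?thesis
      by (cases \<theta>, cases \<theta>\<^sub>0) (simp add: orbit_dist_eq dist_Pair_Pair dist_real_def power2_commute add.commute)
  qed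
  \<comment> \<open>The two one-sided distances are a supremum and an infimum of the same numbers.
    The supremum dominates when \<open>A\<close> is nonempty; when \<open>A\<close> is empty the
    infimum is infinite.\<close>
  have eq: "hausdorff_dist quotient_dist (orbit ` A) {orbit \<theta>\<^sub>0} =
      max (SUP \<theta>\<in>A. ennreal (orbit_dist \<theta> \<theta>\<^sub>0)) (INF \<theta>\<in>A. ennreal (orbit_dist \<theta> \<theta>\<^sub>0))"
    by (simp add: hausdorff_dist_def quotient_dist_orbit sym image_image)
  show ?thesis
  proof (cases "A = {}")
    case True
    then show ?thesis by (simp add: hausdorff_dist_def)
  next
    case False
    then have "(INF \<theta>\<in>A. ennreal (orbit_dist \<theta> \<theta>\<^sub>0)) \<le> (SUP \<theta>\<in>A. ennreal (orbit_dist \<theta> \<theta>\<^sub>0))"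
      by (rule INF_le_SUP)
    then have "hausdorff_dist quotient_dist (orbit ` A) {orbit \<theta>\<^sub>0} = (SUP \<theta>\<in>A. ennreal (orbit_dist \<theta> \<theta>\<^sub>0))"
      by (simp add: eq max_def)
    then show ?thesis
      using False assms by (simp add: less_SUP_iff ennreal_less_iff)
  qed
qed

text \<open>\<open>P\<close> is the exclusive or of \<open>Q\<close> and
  \<open>P \<noteq> Q\<close>, and the latter holds within a null set, hence is measurable in the
  completion.\<close>

lemma pred_completion_cong_AE:
  assumes "AE x in M. P x \<longleftrightarrow> Q x" "{x \<in> space M. Q x} \<in> sets M"
  shows "{x \<in> space M. P x} \<in> sets (completion M)"
proof -
  have [measurable]: "Measurable.pred (completion M) Q"
    using assms(2) by (simp add: pred_def)
  have [measurable]: "Measurable.pred (completion M) (\<lambda>x. P x \<noteq> Q x)"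
    using assms(1) by (intro sets_completion_AE) auto
  have "{x \<in> space (completion M). (Q x \<and> \<not> (P x \<noteq> Q x)) \<or> (\<not> Q x \<and> (P x \<noteq> Q x))} \<in> sets (completion M)"
    by measurable
  also have "{x \<in> space (completion M). (Q x \<and> \<not> (P x \<noteq> Q x)) \<or> (\<not> Q x \<and> (P x \<noteq> Q x))} = {x \<in> space M. P x}"
    by auto
  finally show ?thesis .
qed

section \<open>Consistency for a folded normal sample\<close>

locale folded_normal_sample = prob_space +
  fixes Y :: "nat \<Rightarrow> 'a \<Rightarrow> real" and \<theta>\<^sub>0 :: "real \<times> real"
  assumes \<theta>\<^sub>0: "\<theta>\<^sub>0 \<in> param_space"
    and indep: "indep_vars (\<lambda>_. borel) Y UNIV"
    and dist_Y: "\<And>i. distributed M lborel (Y i) (\<lambda>y. ennreal (folded_normal_density \<theta>\<^sub>0 y))"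
begin

definition pop_mean :: "(real \<Rightarrow> real) \<Rightarrow> real" where
  "pop_mean \<phi> = (\<integral>y. folded_normal_density \<theta>\<^sub>0 y * \<phi> y \<partial>lborel)"

lemma measurable_Y [measurable]: "Y i \<in> borel_measurable M"
  using indep by (simp add: indep_vars_def)

lemma AE_Y_nonneg: "AE \<omega> in M. \<forall>i. 0 \<le> Y i \<omega>"
proof -
  have "AE \<omega> in M. 0 \<le> Y i \<omega>" for i
  proof -
    have "AE y in lborel. 0 < ennreal (folded_normal_density \<theta>\<^sub>0 y) \<longrightarrow> 0 \<le> y"
      by (cases \<theta>\<^sub>0) (auto simp: folded_normal_density_def)
    then have "AE y in distr M lborel (Y i). 0 \<le> y"
      unfolding distributed_distr_eq_density[OF dist_Y] by (subst AE_density) auto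
    then show ?thesis
      by (subst (asm) AE_distr_iff) auto
  qed
  then show ?thesis by (simp add: AE_all_countable)
qed

lemma law_of_large_numbers:
  assumes [measurable]: "\<phi> \<in> borel_measurable borel"
    and \<phi>: "\<And>y. \<bar>\<phi> y\<bar> \<le> C * (1 + y\<^sup>2)" and "\<epsilon> > 0"
  shows "whp (\<lambda>n \<omega>. \<bar>avg (\<lambda>i. \<phi> (Y i \<omega>)) n - pop_mean \<phi>\<bar> < \<epsilon>)"
proof (rule weak_law_of_large_numbers)
  note nonneg = folded_normal_density_nonneg[OF \<theta>\<^sub>0]
  show "indep_vars (\<lambda>_. borel) (\<lambda>i \<omega>. \<phi> (Y i \<omega>)) UNIV"
    by (rule indep_vars_compose2[OF indep]) simp
  fix i
  show "integrable M (\<lambda>\<omega>. \<phi> (Y i \<omega>))"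
    using integrable_folded_normal_density_quadratic(1)[OF \<theta>\<^sub>0 _ \<phi>]
    by (subst distributed_integrable[OF dist_Y, symmetric]) (auto simp: nonneg)
  show "integrable M (\<lambda>\<omega>. (\<phi> (Y i \<omega>))\<^sup>2)"
    using integrable_folded_normal_density_quadratic(2)[OF \<theta>\<^sub>0 _ \<phi>]
    by (subst distributed_integrable[OF dist_Y, symmetric, of "\<lambda>y. (\<phi> y)\<^sup>2"]) (auto simp: nonneg)
  show "expectation (\<lambda>\<omega>. \<phi> (Y i \<omega>)) = pop_mean \<phi>"
    unfolding pop_mean_def by (rule distributed_integral[OF dist_Y, symmetric]) (auto simp: nonneg)
  show "expectation (\<lambda>\<omega>. (\<phi> (Y i \<omega>))\<^sup>2) = pop_mean (\<lambda>y. (\<phi> y)\<^sup>2)"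
    unfolding pop_mean_def
    by (rule distributed_integral[OF dist_Y, symmetric, of "\<lambda>y. (\<phi> y)\<^sup>2"]) (auto simp: nonneg)
qed (use assms in auto)

lemma law_of_large_numbers_log_density:
  assumes "\<epsilon> > 0"
  shows "whp (\<lambda>n \<omega>. \<bar>avg_log_density (\<lambda>i. Y i \<omega>) n \<theta> - pop_mean (log_density \<theta>)\<bar> < \<epsilon>)"
  using log_density_quadratic_bound[of \<theta>]
    law_of_large_numbers[of "log_density \<theta>", OF measurable_log_density _ assms] by blast

lemma pop_variance_pos: "(pop_mean (\<lambda>y. y))\<^sup>2 < pop_mean (\<lambda>y. y\<^sup>2)"
proof -
  let ?m = "pop_mean (\<lambda>y. y)" and ?f = "folded_normal_density \<theta>\<^sub>0"
  have int: "integrable lborel ?f" "integrable lborel (\<lambda>y. ?f y * y)" "integrable lborel (\<lambda>y. ?f y * y\<^sup>2)"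
    using integrable_folded_normal_density[OF \<theta>\<^sub>0] abs_le_1_plus_square
      integrable_folded_normal_density_quadratic[OF \<theta>\<^sub>0, of "\<lambda>y. y" 1]
    by auto
  have eq: "?f y * (y - ?m)\<^sup>2 = ?f y * y\<^sup>2 - (2 * ?m) * (?f y * y) + ?m\<^sup>2 * ?f y" for y
    by (simp add: power2_diff algebra_simps)
  have "0 < (\<integral>y. ?f y * (y - ?m)\<^sup>2 \<partial>lborel)"
  proof (rule integral_folded_normal_density_pos[OF \<theta>\<^sub>0])
    show "integrable lborel (\<lambda>y. ?f y * (y - ?m)\<^sup>2)"
      unfolding eq using int by simp
    \<comment> \<open>To the right of \<open>\<bar>?m\<bar>\<close> the factor
      \<open>(y - ?m)\<^sup>2\<close> has no zero, and this interval lies in the support whatever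
      the sign of \<open>?m\<close>.\<close>
    show "0 \<le> \<bar>?m\<bar>" "\<bar>?m\<bar> < \<bar>?m\<bar> + 1" by auto
  qed auto
  also have "\<dots> = pop_mean (\<lambda>y. y\<^sup>2) - (2 * ?m) * ?m + ?m\<^sup>2 * 1"
    unfolding eq using int integral_folded_normal_density[OF \<theta>\<^sub>0]
    by (simp add: pop_mean_def)
  finally show ?thesis by (simp add: power2_eq_square)
qed

text \<open>The clauses besides compactness hold on the same event and are used with it:
  nonnegativity to rewrite the MLE set, positive sample variance for its existence, and
  \<open>q\<close> as a common factor in front of \<open>log_density_gap\<close>.\<close>

lemma mle_in_compact_whp:
  "\<exists>K q. compact K \<and> K \<subseteq> param_space \<and> 0 < q \<and> whp (\<lambda>n \<omega>. n > 0 \<and> (\<forall>i. 0 \<le> Y i \<omega>) \<and>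
     0 < sample_variance (\<lambda>i. Y i \<omega>) n \<and> 1 + avg (\<lambda>i. (Y i \<omega>)\<^sup>2) n \<le> q \<and>
     mle_set (\<lambda>i. Y i \<omega>) n \<subseteq> K)"
proof -
  define m where "m = pop_mean (\<lambda>y. y)"
  define q where "q = pop_mean (\<lambda>y. y\<^sup>2)"
  define L where "L = pop_mean (log_density \<theta>\<^sub>0)"
  \<comment> \<open>A quarter of the population variance: errors of at most \<open>v\<close> in the
    second moment and in the squared mean still leave a sample variance of at least
    \<open>2 * v\<close>.\<close>
  define v where "v = (q - m\<^sup>2) / 4"
  \<comment> \<open>If the sample mean is within \<open>\<delta> \<le> 1\<close> of
    \<open>m\<close>, its sum with \<open>m\<close> is at most \<open>2 * \<bar>m\<bar> + 1\<close>
    in absolute value, so the squares differ by at most \<open>v\<close>.\<close>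
  define \<delta> where "\<delta> = min 1 (v / (2 * \<bar>m\<bar> + 1))"
  have v: "v > 0"
    using pop_variance_pos by (simp add: v_def m_def q_def)
  have \<delta>: "\<delta> > 0" "\<delta> \<le> 1" "\<delta> * (2 * \<bar>m\<bar> + 1) \<le> v"
  proof -
    have "2 * \<bar>m\<bar> + 1 > 0" by simp
    then show "\<delta> > 0" "\<delta> * (2 * \<bar>m\<bar> + 1) \<le> v"
      using v by (auto simp: \<delta>_def simp flip: pos_le_divide_eq)
    show "\<delta> \<le> 1" by (simp add: \<delta>_def)
  qed
  \<comment> \<open>A maximiser does at least as well as \<open>\<theta>\<^sub>0\<close>, whose
    average log density exceeds \<open>L - 1\<close> on the event considered.\<close>
  obtain K where K: "compact K" "K \<subseteq> param_space" and
    K': "\<And>\<mu> \<sigma> x s. \<sigma> > 0 \<Longrightarrow> v \<le> s \<Longrightarrow> \<bar>x\<bar> \<le> \<bar>m\<bar> + 1 \<Longrightarrow>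
    L - 1 \<le> - ln \<sigma> - (s + (\<bar>\<mu>\<bar> - x)\<^sup>2) / (2 * \<sigma>\<^sup>2) \<Longrightarrow> (\<mu>, \<sigma>) \<in> K"
    using coercive_region_compact[OF v, of "\<bar>m\<bar> + 1" "L - 1"] by blast
  have "whp (\<lambda>n \<omega>. (n > 0 \<and> (\<forall>i. 0 \<le> Y i \<omega>)) \<and> \<bar>avg (\<lambda>i. Y i \<omega>) n - m\<bar> < \<delta> \<and>
      \<bar>avg (\<lambda>i. (Y i \<omega>)\<^sup>2) n - q\<bar> < v \<and> \<bar>avg_log_density (\<lambda>i. Y i \<omega>) n \<theta>\<^sub>0 - L\<bar> < 1)"
  proof (intro whp_conj)
    show "whp (\<lambda>n \<omega>. n > 0)" "whp (\<lambda>n \<omega>. \<forall>i. 0 \<le> Y i \<omega>)"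
      using AE_Y_nonneg by (auto intro: whp_AE[of 1])
    show "whp (\<lambda>n \<omega>. \<bar>avg (\<lambda>i. Y i \<omega>) n - m\<bar> < \<delta>)"
      unfolding m_def using \<delta> abs_le_1_plus_square
      by (intro law_of_large_numbers[of "\<lambda>y. y" 1]) auto
    show "whp (\<lambda>n \<omega>. \<bar>avg (\<lambda>i. (Y i \<omega>)\<^sup>2) n - q\<bar> < v)"
      unfolding q_def using v by (intro law_of_large_numbers[of "\<lambda>y. y\<^sup>2" 1]) auto
    show "whp (\<lambda>n \<omega>. \<bar>avg_log_density (\<lambda>i. Y i \<omega>) n \<theta>\<^sub>0 - L\<bar> < 1)"
      unfolding L_def by (rule law_of_large_numbers_log_density) simp
  qed
  then have "whp (\<lambda>n \<omega>. n > 0 \<and> (\<forall>i. 0 \<le> Y i \<omega>) \<and>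
     0 < sample_variance (\<lambda>i. Y i \<omega>) n \<and> 1 + avg (\<lambda>i. (Y i \<omega>)\<^sup>2) n \<le> 1 + q + v \<and>
     mle_set (\<lambda>i. Y i \<omega>) n \<subseteq> K)"
  proof (rule whp_mono)
    fix n \<omega>
    let ?y = "\<lambda>i. Y i \<omega>"
    assume *: "(n > 0 \<and> (\<forall>i. 0 \<le> Y i \<omega>)) \<and> \<bar>avg ?y n - m\<bar> < \<delta> \<and>
      \<bar>avg (\<lambda>i. (Y i \<omega>)\<^sup>2) n - q\<bar> < v \<and> \<bar>avg_log_density ?y n \<theta>\<^sub>0 - L\<bar> < 1"
    have am: "\<bar>avg ?y n\<bar> \<le> \<bar>m\<bar> + 1"
      using * \<delta>(2) by linarith
    have "\<bar>(avg ?y n)\<^sup>2 - m\<^sup>2\<bar> = \<bar>avg ?y n - m\<bar> * \<bar>avg ?y n + m\<bar>"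
      by (simp add: power2_eq_square square_diff_square_factored abs_mult mult.commute)
    also have "\<dots> \<le> \<delta> * (2 * \<bar>m\<bar> + 1)"
      using * am by (intro mult_mono) auto
    finally have "(avg ?y n)\<^sup>2 \<le> m\<^sup>2 + v"
      using \<delta>(3) by linarith
    moreover have "\<bar>avg (\<lambda>i. (Y i \<omega>)\<^sup>2) n - q\<bar> < v"
      using * by blast
    moreover have "q = 4 * v + m\<^sup>2"
      by (simp add: v_def field_simps)
    ultimately have sv: "v \<le> sample_variance ?y n"
      using v by linarith
    have "mle_set ?y n \<subseteq> K"
    proof
      fix \<theta> assume "\<theta> \<in> mle_set ?y n"
      then have \<theta>: "\<theta> \<in> param_space" "avg_log_density ?y n \<theta>\<^sub>0 \<le> avg_log_density ?y n \<theta>"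
        using * \<theta>\<^sub>0 by (auto simp: mle_set_eq)
      obtain \<mu> \<sigma> where eq: "\<theta> = (\<mu>, \<sigma>)" by (cases \<theta>)
      then have \<sigma>: "\<sigma> > 0" using \<theta> by (simp add: param_space_def)
      have "L - 1 \<le> avg_log_density ?y n (\<mu>, \<sigma>)"
        using * \<theta>(2) unfolding eq by linarith
      also have "\<dots> \<le> - ln \<sigma> - (sample_variance ?y n + (\<bar>\<mu>\<bar> - avg ?y n)\<^sup>2) / (2 * \<sigma>\<^sup>2)"
        using * \<sigma> by (intro avg_log_density_le) auto
      finally show "\<theta> \<in> K"
        unfolding eq using \<sigma> sv am by (intro K') auto
    qed
    moreover have "0 < sample_variance ?y n"
      using sv v by linarith
    ultimately show "n > 0 \<and> (\<forall>i. 0 \<le> Y i \<omega>) \<and> 0 < sample_variance ?y n \<and>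
      1 + avg (\<lambda>i. (Y i \<omega>)\<^sup>2) n \<le> 1 + q + v \<and> mle_set ?y n \<subseteq> K"
      using * by (auto simp: abs_less_iff)
  qed
  moreover have "0 < 1 + q + v"
  proof -
    have "m\<^sup>2 < q" using v by (simp add: v_def)
    then have "0 < q" by (rule le_less_trans[OF zero_le_power2])
    with v show ?thesis by linarith
  qed
  ultimately show ?thesis using K by blast
qed

theorem mle_consistent:
  assumes \<epsilon>: "\<epsilon> > 0"
  shows "whp (\<lambda>n \<omega>. mle_set (\<lambda>i. Y i \<omega>) n \<noteq> {} \<and> (\<forall>\<theta>\<in>mle_set (\<lambda>i. Y i \<omega>) n. orbit_dist \<theta> \<theta>\<^sub>0 < \<epsilon>))"
proof -
  obtain K q where K: "compact K" "K \<subseteq> param_space" and q: "q > 0" and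
    whpK: "whp (\<lambda>n \<omega>. n > 0 \<and> (\<forall>i. 0 \<le> Y i \<omega>) \<and>
     0 < sample_variance (\<lambda>i. Y i \<omega>) n \<and> 1 + avg (\<lambda>i. (Y i \<omega>)\<^sup>2) n \<le> q \<and>
     mle_set (\<lambda>i. Y i \<omega>) n \<subseteq> K)"
    using mle_in_compact_whp by blast
  define C where "C = K \<inter> {\<theta>. \<epsilon> \<le> orbit_dist \<theta> \<theta>\<^sub>0}"
  define L where "L \<theta> = pop_mean (log_density \<theta>)" for \<theta>
  \<comment> \<open>A quarter of the gap in means, because three errors below
    \<open>\<delta> \<theta>\<close> occur: sampling error at \<open>\<theta>\<close>, sampling
    error at \<open>\<theta>\<^sub>0\<close>, and the change from \<open>\<theta>\<close> to a
    maximiser in \<open>U \<theta>\<close>.\<close>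
  define \<delta> where "\<delta> \<theta> = (L \<theta>\<^sub>0 - L \<theta>) / 4" for \<theta>
  \<comment> \<open>The factor \<open>1 + avg (\<lambda>i. (Y i \<omega>)\<^sup>2) n\<close> of the
    gap is at most \<open>q\<close> on the event considered, so dividing by \<open>q\<close> keeps
    the change of the average below \<open>\<delta> \<theta>\<close>.\<close>
  define U where "U \<theta> = param_space \<inter> log_density_gap \<theta> -` {..<\<delta> \<theta> / q}" for \<theta>
  have \<delta>: "\<delta> \<theta> > 0" if "\<theta> \<in> C" for \<theta>
  proof -
    have "\<theta> \<in> param_space" "orbit_dist \<theta> \<theta>\<^sub>0 \<noteq> 0"
      using that K(2) \<epsilon> by (auto simp: C_def)
    then have "L \<theta> < L \<theta>\<^sub>0"
      unfolding L_def pop_mean_def by (intro log_density_gibbs \<theta>\<^sub>0)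
    then show ?thesis by (simp add: \<delta>_def)
  qed
  have "compact C"
    unfolding C_def using continuous_on_orbit_dist[of UNIV \<theta>\<^sub>0]
    by (intro compact_Int_closed K closed_Collect_le continuous_intros)
  moreover have "open (U \<theta>)" for \<theta>
    unfolding U_def
    by (intro continuous_open_preimage continuous_on_log_density_gap)
      (auto simp: param_space_def open_Times)
  moreover have "C \<subseteq> (\<Union>\<theta>\<in>C. U \<theta>)"
    using \<delta> q K(2) by (auto simp: U_def C_def)
  ultimately obtain F where F: "F \<subseteq> C" "finite F" "C \<subseteq> (\<Union>\<theta>\<in>F. U \<theta>)"
    using compactE_image[of C C U] by metis
  have "whp (\<lambda>n \<omega>. \<forall>\<theta>\<in>F. \<bar>avg_log_density (\<lambda>i. Y i \<omega>) n \<theta> - L \<theta>\<bar> < \<delta> \<theta> \<and>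
      \<bar>avg_log_density (\<lambda>i. Y i \<omega>) n \<theta>\<^sub>0 - L \<theta>\<^sub>0\<bar> < \<delta> \<theta>)"
    unfolding L_def using F \<delta>
    by (intro whp_ball_finite whp_conj law_of_large_numbers_log_density) auto
  from whp_conj[OF whpK this] show ?thesis
  proof (rule whp_mono)
    fix n \<omega>
    let ?y = "\<lambda>i. Y i \<omega>"
    assume *: "(n > 0 \<and> (\<forall>i. 0 \<le> Y i \<omega>) \<and> 0 < sample_variance ?y n \<and>
      1 + avg (\<lambda>i. (Y i \<omega>)\<^sup>2) n \<le> q \<and> mle_set ?y n \<subseteq> K) \<and>
      (\<forall>\<theta>\<in>F. \<bar>avg_log_density ?y n \<theta> - L \<theta>\<bar> < \<delta> \<theta> \<and> \<bar>avg_log_density ?y n \<theta>\<^sub>0 - L \<theta>\<^sub>0\<bar> < \<delta> \<theta>)"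
    show "mle_set ?y n \<noteq> {} \<and> (\<forall>\<theta>\<in>mle_set ?y n. orbit_dist \<theta> \<theta>\<^sub>0 < \<epsilon>)"
    proof (intro conjI ballI)
      show "mle_set ?y n \<noteq> {}"
        using * by (intro mle_set_nonempty) auto
      fix \<theta>' assume \<theta>': "\<theta>' \<in> mle_set ?y n"
      show "orbit_dist \<theta>' \<theta>\<^sub>0 < \<epsilon>"
      proof (rule ccontr)
        assume "\<not> ?thesis"
        then have "\<theta>' \<in> C" using * \<theta>' by (auto simp: C_def)
        then obtain \<theta> where \<theta>: "\<theta> \<in> F" "\<theta>' \<in> U \<theta>" using F(3) by blast
        have "\<bar>avg_log_density ?y n \<theta> - avg_log_density ?y n \<theta>'\<bar> \<le>
            (1 + avg (\<lambda>i. (Y i \<omega>)\<^sup>2) n) * log_density_gap \<theta> \<theta>'"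
          using * by (intro avg_log_density_diff_le) auto
        also have "\<dots> \<le> q * log_density_gap \<theta> \<theta>'"
          using * by (intro mult_right_mono log_density_gap_nonneg) auto
        also have "\<dots> < \<delta> \<theta>"
          using \<theta>(2) q by (simp add: U_def field_simps)
        finally have "avg_log_density ?y n \<theta>' < avg_log_density ?y n \<theta> + \<delta> \<theta>" by linarith
        moreover have "avg_log_density ?y n \<theta>\<^sub>0 \<le> avg_log_density ?y n \<theta>'"
          using \<theta>' * \<theta>\<^sub>0 by (auto simp: mle_set_eq)
        moreover have "\<bar>avg_log_density ?y n \<theta> - L \<theta>\<bar> < \<delta> \<theta>" "\<bar>avg_log_density ?y n \<theta>\<^sub>0 - L \<theta>\<^sub>0\<bar> < \<delta> \<theta>"
          using * \<theta>(1) by auto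
        moreover have "\<delta> \<theta> > 0" using F(1) \<theta>(1) by (intro \<delta>) blast
        ultimately show False unfolding \<delta>_def by argo
      qed
    qed
  qed
qed

section \<open>Measurability and convergence in probability\<close>

lemma hausdorff_dist_mle_measurable:
  "(\<lambda>\<omega>. hausdorff_dist quotient_dist (orbit ` mle_set (\<lambda>i. Y i \<omega>) n) {orbit \<theta>\<^sub>0})
     \<in> borel_measurable (completion M)"
proof (cases "n = 0")
  case True
  \<comment> \<open>An empty sum makes the MLE set independent of \<open>\<omega>\<close>, so the
    function is constant.\<close>
  then show ?thesis by (simp add: mle_set_def log_likelihood_def[abs_def])
next
  case False
  then have n: "n > 0" by simp
  obtain E :: "(real \<times> real) set" where E: "countable E" "\<And>X. open X \<Longrightarrow> X \<noteq> {} \<Longrightarrow> \<exists>d\<in>E. d \<in> X"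
    using countable_dense_exists by blast
  define D where "D = E \<inter> param_space"
  have D: "countable D" "D \<subseteq> param_space"
    and dense: "\<And>U. open U \<Longrightarrow> U \<subseteq> param_space \<Longrightarrow> U \<noteq> {} \<Longrightarrow> \<exists>d\<in>D. d \<in> U"
  proof -
    show "countable D" "D \<subseteq> param_space"
      using E(1) by (auto simp: D_def)
    show "\<exists>d\<in>D. d \<in> U" if "open U" "U \<subseteq> param_space" "U \<noteq> {}" for U
      using E(2)[OF that(1,3)] that(2) by (auto simp: D_def)
  qed
  have [measurable]: "(\<lambda>\<omega>. avg_log_density (\<lambda>i. Y i \<omega>) n \<theta>) \<in> borel_measurable M" for \<theta>
    unfolding avg_def by simp
  define R where "R c' k \<omega> \<longleftrightarrow> (\<forall>q\<in>D. \<exists>r\<in>D. of_rat c' < orbit_dist r \<theta>\<^sub>0 \<and>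
      avg_log_density (\<lambda>i. Y i \<omega>) n q - 1 / Suc k < avg_log_density (\<lambda>i. Y i \<omega>) n r)"
    for c' :: rat and k :: nat and \<omega>
  \<comment> \<open>The first alternative accounts for the empty MLE set at infinite distance.
    \<open>Q c\<close> is measurable in \<open>M\<close> and can differ from the event in question
    only where some observation is negative.\<close>
  define Q where "Q c \<omega> \<longleftrightarrow> (\<forall>i<n. Y i \<omega> = Y 0 \<omega>) \<or> (\<exists>c'. c < of_rat c' \<and> (\<forall>k. R c' k \<omega>))"
    for c :: real and \<omega>
  have [measurable]: "Measurable.pred M (R c' k)" for c' k
    unfolding R_def by (intro measurable_pred_countable[OF D(1)]) measurable
  have Q_sets: "{\<omega> \<in> space M. Q c \<omega>} \<in> sets M" for c
    unfolding Q_def by measurable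
  have Q_iff: "ennreal c < hausdorff_dist quotient_dist (orbit ` mle_set (\<lambda>i. Y i \<omega>) n) {orbit \<theta>\<^sub>0}
      \<longleftrightarrow> Q c \<omega>" if c: "0 \<le> c" and nonneg: "\<forall>i. 0 \<le> Y i \<omega>" for c \<omega>
  proof (cases "\<forall>i<n. Y i \<omega> = Y 0 \<omega>")
    case True
    then have "mle_set (\<lambda>i. Y i \<omega>) n = {}"
      using nonneg by (intro mle_set_constant_sample[OF n, of _ "Y 0 \<omega>"]) blast+
    moreover have "Q c \<omega>"
      unfolding Q_def using True by blast
    ultimately show ?thesis
      unfolding hausdorff_dist_singleton[OF c] by blast
  next
    case False
    then have v: "0 < sample_variance (\<lambda>i. Y i \<omega>) n"
      using sample_variance_pos[of _ n "\<lambda>i. Y i \<omega>"] by blast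
    then have "mle_set (\<lambda>i. Y i \<omega>) n \<noteq> {}"
      using n nonneg by (intro mle_set_nonempty) auto
    moreover have "(\<exists>\<theta>\<in>mle_set (\<lambda>i. Y i \<omega>) n. c < orbit_dist \<theta> \<theta>\<^sub>0) \<longleftrightarrow>
        (\<exists>c'. c < of_rat c' \<and> (\<forall>k. R c' k \<omega>))"
      unfolding R_def
      by (rule ex_mle_orbit_dist_gt_iff[OF n _ v D(2) dense]) (use nonneg in auto)
    then have "(\<exists>\<theta>\<in>mle_set (\<lambda>i. Y i \<omega>) n. c < orbit_dist \<theta> \<theta>\<^sub>0) \<longleftrightarrow> Q c \<omega>"
      unfolding Q_def using False by blast
    ultimately show ?thesis
      unfolding hausdorff_dist_singleton[OF c] by blast
  qed
  show ?thesis
  proof (rule borel_measurableI_greater)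
    fix x :: ennreal
    show "{\<omega> \<in> space (completion M). x <
        hausdorff_dist quotient_dist (orbit ` mle_set (\<lambda>i. Y i \<omega>) n) {orbit \<theta>\<^sub>0}} \<in> sets (completion M)"
    proof (cases x)
      case (real c)
      have "AE \<omega> in M. x < hausdorff_dist quotient_dist (orbit ` mle_set (\<lambda>i. Y i \<omega>) n) {orbit \<theta>\<^sub>0}
          \<longleftrightarrow> Q c \<omega>"
        using AE_Y_nonneg by eventually_elim (use real Q_iff[of c] in simp)
      from pred_completion_cong_AE[OF this Q_sets] show ?thesis by simp
    qed simp
  qed
qed

text \<open>A distance above \<open>\<epsilon>\<close> means an empty MLE set or a maximiser farther
  than \<open>\<epsilon>\<close> from the orbit. \<open>mle_consistent\<close> excludes both, which
  is why nonemptiness is part of it.\<close>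

lemma hausdorff_dist_mle_tendsto_0:
  "tendsto_0_in_prob (completion M)
     (\<lambda>n \<omega>. hausdorff_dist quotient_dist (orbit ` mle_set (\<lambda>i. Y i \<omega>) n) {orbit \<theta>\<^sub>0})"
  unfolding tendsto_0_in_prob_def
proof (intro conjI allI impI)
  fix \<epsilon> :: real assume \<epsilon>: "\<epsilon> > 0"
  show "(\<lambda>n. measure (completion M) {\<omega> \<in> space (completion M). ennreal \<epsilon> <
      hausdorff_dist quotient_dist (orbit ` mle_set (\<lambda>i. Y i \<omega>) n) {orbit \<theta>\<^sub>0}}) \<longlonglongrightarrow> 0"
  proof (rule whp_measure_tendsto_0[OF mle_consistent[OF \<epsilon>]])
    show "{\<omega> \<in> space (completion M). ennreal \<epsilon> <
      hausdorff_dist quotient_dist (orbit ` mle_set (\<lambda>i. Y i \<omega>) n) {orbit \<theta>\<^sub>0}} \<in> sets (completion M)" for n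
      using hausdorff_dist_mle_measurable[of n] by measurable
  qed (use \<epsilon> in \<open>fastforce simp: hausdorff_dist_singleton\<close>)
qed (rule hausdorff_dist_mle_measurable)

text \<open>Being a maximiser from \<open>n = 2\<close> on is enough for \<open>whp\<close>. The
  orbit distance is continuous, so measurability of \<open>T n\<close> puts the events in
  \<open>M\<close>, where the measure agrees with that of the completion.\<close>

lemma orbit_dist_mle_selection_tendsto_0:
  assumes T [measurable]: "\<And>n. T n \<in> borel_measurable M"
    and mle: "\<And>n. n \<ge> 2 \<Longrightarrow> AE \<omega> in M. T n \<omega> \<in> mle_set (\<lambda>i. Y i \<omega>) n"
  shows "tendsto_0_in_prob M (\<lambda>n \<omega>. ennreal (orbit_dist (T n \<omega>) \<theta>\<^sub>0))"
  unfolding tendsto_0_in_prob_def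
proof (intro conjI allI impI)
  have [measurable]: "(\<lambda>\<omega>. orbit_dist (T n \<omega>) \<theta>\<^sub>0) \<in> borel_measurable M" for n
    by (rule borel_measurable_continuous_on[OF continuous_on_orbit_dist T])
  show [measurable]: "(\<lambda>\<omega>. ennreal (orbit_dist (T n \<omega>) \<theta>\<^sub>0)) \<in> borel_measurable M" for n
    by measurable
  fix \<epsilon> :: real assume \<epsilon>: "\<epsilon> > 0"
  have sets: "{\<omega> \<in> space M. ennreal \<epsilon> < ennreal (orbit_dist (T n \<omega>) \<theta>\<^sub>0)} \<in> sets M" for n
    by measurable
  have "(\<lambda>n. measure (completion M) {\<omega> \<in> space M. ennreal \<epsilon> < ennreal (orbit_dist (T n \<omega>) \<theta>\<^sub>0)}) \<longlonglongrightarrow> 0"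
  proof (rule whp_measure_tendsto_0[OF whp_conj[OF mle_consistent[OF \<epsilon>] whp_AE[of 2, OF mle]]])
    show "{\<omega> \<in> space M. ennreal \<epsilon> < ennreal (orbit_dist (T n \<omega>) \<theta>\<^sub>0)} \<in> sets (completion M)" for n
      using sets by blast
    show "\<not> ((mle_set (\<lambda>i. Y i \<omega>) n \<noteq> {} \<and> (\<forall>\<theta>\<in>mle_set (\<lambda>i. Y i \<omega>) n. orbit_dist \<theta> \<theta>\<^sub>0 < \<epsilon>)) \<and>
        T n \<omega> \<in> mle_set (\<lambda>i. Y i \<omega>) n)"
      if "\<omega> \<in> {\<omega> \<in> space M. ennreal \<epsilon> < ennreal (orbit_dist (T n \<omega>) \<theta>\<^sub>0)}" for n \<omega>
    proof -
      have "\<not> orbit_dist (T n \<omega>) \<theta>\<^sub>0 < \<epsilon>"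
        using that \<epsilon> by (simp add: ennreal_less_iff)
      then show ?thesis by blast
    qed
  qed
  then show "(\<lambda>n. prob {\<omega> \<in> space M. ennreal \<epsilon> < ennreal (orbit_dist (T n \<omega>) \<theta>\<^sub>0)}) \<longlonglongrightarrow> 0"
    using sets by simp
qed

end

theorem theorem3p10:
  fixes M :: "'a measure"
    and Y :: "nat \<Rightarrow> 'a \<Rightarrow> real"
    and \<theta>\<^sub>0 :: "real \<times> real"
  assumes "prob_space M"
    and "\<theta>\<^sub>0 \<in> param_space"
    and "prob_space.indep_vars M (\<lambda>_. borel) Y UNIV"
    and "\<And>i. distributed M lborel (Y i) (\<lambda>y. ennreal (folded_normal_density \<theta>\<^sub>0 y))"
  shows "tendsto_0_in_prob (completion M)
           (\<lambda>n \<omega>. hausdorff_dist quotient_dist (orbit ` mle_set (\<lambda>i. Y i \<omega>) n) {orbit \<theta>\<^sub>0})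
       \<and> (\<forall>T :: nat \<Rightarrow> 'a \<Rightarrow> real \<times> real.
            (\<forall>n. T n \<in> borel_measurable M) \<longrightarrow>
            (\<forall>n\<ge>2. AE \<omega> in M. T n \<omega> \<in> mle_set (\<lambda>i. Y i \<omega>) n) \<longrightarrow>
            tendsto_0_in_prob M (\<lambda>n \<omega>. ennreal (orbit_dist (T n \<omega>) \<theta>\<^sub>0)))"
proof -
  interpret folded_normal_sample M Y \<theta>\<^sub>0
    using assms by (simp add: folded_normal_sample_def folded_normal_sample_axioms_def)
  show ?thesis
    using hausdorff_dist_mle_tendsto_0 orbit_dist_mle_selection_tendsto_0 by blast
qed

end
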